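(* Let $\rho>0$ and, for $\alpha>0$ and $a,b\ge 0$, consider the system for real-valued functions $(U,V)$ $$(\mathrm{S}_{a,b,\alpha})\qquad \begin{cases}U''+U^3-\alpha (V+\rho)U=0\\ (aV^2-bV^3)'=\alpha (U^2)'\end{cases}\qquad\text{in }\mathbb{R}.$$ Then: 1. Let $\alpha>0$ and assume that $a=0$ and $b>0$. Then $(\mathrm{S}_{0,b,\alpha})$ admits a solution $(U,V)$ with $$U\in H_{rd}^1(\mathbb{R})\text{ positive},\qquad V(x)=-\left(\frac{\alpha}{b}\right)^{1/3}U^{2/3}(x).$$ 2. Let $\alpha>0$ and assume that $a>0$ and $b=0$. Then $(\mathrm{S}_{a,0,\alpha})$ admits two solutions $(U_1,V_1)$ and $(U_2,V_2)$ with $$U_1\in H_{rd}^1(\mathbb{R})\text{ positive},\qquad V_1(x)=-\left(\frac{\alpha}{a}\right)^{1/2}U_1(x),$$ and $$U_2\in H_{rd}^1(\mathbb{R})\text{ positive},\qquad V_2(x)=\left(\frac{\alpha}{a}\right)^{1/2}U_2(x).$$ 3. Let $a,b>0$. Then, for all sufficiently small $\alpha>0$, $(\mathrm{S}_{a,b,\alpha})$ admits two solutions $(U_1,V_1)$ and $(U_2,V_2)$ with $$U_1>0,\ V_1>0\qquad\text{and}\qquad U_2>0,\ V_2<0,$$ where $U_i\in H^1(\mathbb{R})$ and $aV_i^2-bV_i^3=\alpha U_i^2$ for $i=1,2$.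
   Context: $H^1_{rd}(\mathbb{R})$ denotes the set of (real-valued) functions in $H^1(\mathbb{R})$ which are even and decreasing in $|x|$. *)

theory Defs
  imports "HOL-Analysis.Analysis"
begin

definition square_integrable :: "(real \<Rightarrow> real) \<Rightarrow> bool" where
  "square_integrable f \<longleftrightarrow>
     f \<in> borel_measurable lebesgue \<and> integrable lebesgue (\<lambda>x. (f x)\<^sup>2)"

definition test_function :: "(real \<Rightarrow> real) \<Rightarrow> bool" where
  "test_function \<phi> \<longleftrightarrow>
     (\<forall>n. (deriv ^^ n) \<phi> differentiable_on UNIV) \<and> compact (closure {x. \<phi> x \<noteq> 0})"

definition weak_derivative :: "(real \<Rightarrow> real) \<Rightarrow> (real \<Rightarrow> real) \<Rightarrow> bool" where
  "weak_derivative f g \<longleftrightarrow>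
     (\<forall>\<phi>. test_function \<phi> \<longrightarrow>
        integral\<^sup>L lebesgue (\<lambda>x. f x * deriv \<phi> x) = - integral\<^sup>L lebesgue (\<lambda>x. g x * \<phi> x))"

text \<open>
  The Sobolev space \<open>H\<^sup>1(\<real>)\<close>, as a set of functions rather than of classes
  modulo null sets: the pointwise statements below concern the given representative.
\<close>

definition H1 :: "(real \<Rightarrow> real) set" where
  "H1 = {f. square_integrable f \<and> (\<exists>g. square_integrable g \<and> weak_derivative f g)}"

text \<open>``Decreasing in \<open>\<bar>x\<bar>\<close>'' is meant in the wide sense, so that \<open>0\<close> belongs to the set.\<close>

definition H1_rd :: "(real \<Rightarrow> real) set" where
  "H1_rd = {f \<in> H1. (\<forall>x. f (- x) = f x) \<and> (\<forall>x y. \<bar>x\<bar> \<le> \<bar>y\<bar> \<longrightarrow> f y \<le> f x)}"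

text \<open>
  Solutions are classical: \<open>U\<close> is of class \<open>C\<^sup>2\<close>, \<open>V\<close> is of class \<open>C\<^sup>1\<close>, and both
  equations hold at every point.
\<close>

definition solves_S :: "real \<Rightarrow> real \<Rightarrow> real \<Rightarrow> real \<Rightarrow> (real \<Rightarrow> real) \<Rightarrow> (real \<Rightarrow> real) \<Rightarrow> bool" where
  "solves_S \<rho> a b \<alpha> U V \<longleftrightarrow>
     U C1_differentiable_on UNIV \<and> deriv U C1_differentiable_on UNIV \<and>
     V C1_differentiable_on UNIV \<and>
     (\<forall>x. deriv (deriv U) x + U x ^ 3 - \<alpha> * (V x + \<rho>) * U x = 0) \<and>
     (\<forall>x. deriv (\<lambda>y. a * V y ^ 2 - b * V y ^ 3) x = \<alpha> * deriv (\<lambda>y. U y ^ 2) x)"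

end

theory Submission
  imports Defs "HOL-Complex_Analysis.Conformal_Mappings"
begin

text \<open>
  On a branch \<open>V = v(U)\<close> of the algebraic constraint \<open>a V\<^sup>2 - b V\<^sup>3 = \<alpha> U\<^sup>2\<close> the system reduces to
  \<open>U'' = P'(U) / 2\<close> with \<open>P(u) = \<alpha> \<rho> u\<^sup>2 + \<alpha> \<Psi>(u) - u\<^sup>4 / 2\<close> and \<open>\<Psi>'(u) = 2 u v(u)\<close>. Let \<open>M\<close> be the
  first positive zero of \<open>P\<close>. If \<open>P'(M) < 0\<close>, the zero energy level \<open>U'\<^sup>2 = P(U)\<close> carries a
  homoclinic orbit with maximum \<open>M\<close>. The substitution \<open>U = M - S\<^sup>2\<close> makes the quadrature regular
  at the maximum: \<open>S\<close> is the inverse of a primitive of \<open>2 / sqrt (P(M - s\<^sup>2) / s\<^sup>2)\<close>. Since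
  \<open>P(u) \<sim> \<alpha> \<rho> u\<^sup>2\<close> at \<open>0\<close>, the orbit decays exponentially and lies in \<open>H\<^sup>1\<close>.

  The condition \<open>P'(M) < 0\<close> amounts to \<open>v(M) M\<^sup>2 < \<rho> M\<^sup>2 + 2 \<Psi>(M)\<close>. On a negative decreasing branch
  it is automatic because \<open>\<Psi>(M) \<ge> v(M) M\<^sup>2\<close>; on a positive linear branch \<open>2 \<Psi>(M)\<close> is
  \<open>4/3\<close> of \<open>v(M) M\<^sup>2\<close>; and on the positive branch with \<open>a, b > 0\<close> it holds as soon as \<open>v \<le> \<rho>\<close> up to
  \<open>M\<close>, which is where small \<open>\<alpha>\<close> is needed.
\<close>

section \<open>Membership in \<open>H\<^sup>1\<close>\<close>

text \<open>Continuity bounds \<open>f\<close> on the compact middle part, and enlarging the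
  constant extends the exponential bound to the whole line. The square is then dominated by an
  integrable exponential.\<close>

lemma square_integrable_exp_decay:
  fixes f :: "real \<Rightarrow> real"
  assumes cont: "continuous_on UNIV f" and k: "k > 0"
    and decay: "\<And>x. \<bar>x\<bar> \<ge> X \<Longrightarrow> \<bar>f x\<bar> \<le> K * exp (- k * \<bar>x\<bar>)"
  shows "square_integrable f"
proof -
  have "compact (f ` {-X..X})"
    using cont by (intro compact_continuous_image continuous_on_subset[OF cont]) auto
  then obtain B where B: "\<And>x. x \<in> {-X..X} \<Longrightarrow> \<bar>f x\<bar> \<le> B"
    using compact_imp_bounded bounded_iff by (metis imageI real_norm_def)
  define C where "C = max 0 K + max 0 B * exp (k * X)"
  have bound: "\<bar>f x\<bar> \<le> C * exp (- k * \<bar>x\<bar>)" for x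
  proof (cases "\<bar>x\<bar> \<ge> X")
    case True
    have "K \<le> C"
      unfolding C_def by (smt (verit) exp_gt_zero mult_nonneg_nonneg)
    then show ?thesis
      using decay[OF True] by (smt (verit) exp_gt_zero mult_right_mono)
  next
    case False
    have "\<bar>f x\<bar> \<le> max 0 B"
      using B[of x] False by force
    also have "\<dots> \<le> max 0 B * exp (k * (X - \<bar>x\<bar>))"
      using False k by (simp add: mult_le_cancel_left1)
    also have "\<dots> = max 0 B * exp (k * X) * exp (- k * \<bar>x\<bar>)"
      by (simp add: algebra_simps flip: exp_add)
    also have "\<dots> \<le> C * exp (- k * \<bar>x\<bar>)"
      unfolding C_def by (intro mult_right_mono) auto
    finally show ?thesis .
  qed
  have meas: "f \<in> borel_measurable lebesgue"
    using borel_measurable_continuous_onI[OF cont] by (simp add: measurable_completion)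
  \<comment> \<open>A half-line exponential plus its reflection dominates
    \<open>exp (- (2 * k) * \<bar>x\<bar>)\<close>. Reflection is applied for Borel-Lebesgue
    measure, and the result is carried back to the completion.\<close>
  define e where "e x = indicat_real {0..} x * exp (- (2 * k) * x)" for x
  define h where "h x = C\<^sup>2 * (e x + e (- x))" for x
  have "(\<lambda>x. exp (- (2 * k) * x)) absolutely_integrable_on {0..}"
    using integrable_on_exp_minus_to_infinity[of "2 * k" 0] k
    by (subst absolutely_integrable_on_iff_nonneg) auto
  then have "integrable lebesgue e"
    by (simp add: set_integrable_def e_def[abs_def])
  moreover have e_meas: "e \<in> borel_measurable lborel"
    unfolding e_def by measurable
  ultimately have e: "integrable lborel e"
    by (simp add: integrable_completion)
  then have "integrable lborel (\<lambda>x. e (- x))"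
    using lborel_integrable_real_affine[of e "-1" 0] by simp
  with e have "integrable lborel h"
    unfolding h_def by auto
  then have "integrable lebesgue h"
    by (subst integrable_completion) auto
  then have "integrable lebesgue (\<lambda>x. (f x)\<^sup>2)"
  proof (rule Bochner_Integration.integrable_bound)
    show "AE x in lebesgue. norm ((f x)\<^sup>2) \<le> norm (h x)"
    proof (rule AE_I2)
      fix x
      have "(f x)\<^sup>2 \<le> (C * exp (- k * \<bar>x\<bar>))\<^sup>2"
        using bound[of x] by (intro abs_le_square_iff[THEN iffD1]) linarith
      also have "\<dots> = C\<^sup>2 * exp (- (2 * k) * \<bar>x\<bar>)"
        by (simp add: power_mult_distrib mult.assoc flip: exp_double)
      also have "\<dots> \<le> h x"
        unfolding h_def by (intro mult_left_mono) (auto simp: e_def indicator_def)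
      finally show "norm ((f x)\<^sup>2) \<le> norm (h x)"
        by simp
    qed
  qed (use meas in measurable)
  with meas show ?thesis
    by (simp add: square_integrable_def)
qed

text \<open>Integration by parts: \<open>f * \<phi>\<close> vanishes at both ends of an interval
  around the support of \<open>\<phi>\<close>, so the integral of its derivative is zero.\<close>

lemma weak_derivative_C1:
  fixes f f' :: "real \<Rightarrow> real"
  assumes der: "\<And>x. (f has_real_derivative f' x) (at x)" and cont: "continuous_on UNIV f'"
  shows "weak_derivative f f'"
  unfolding weak_derivative_def
proof (intro allI impI)
  fix \<phi> assume \<phi>: "test_function \<phi>"
  have "(deriv ^^ 0) \<phi> differentiable_on UNIV" "(deriv ^^ 1) \<phi> differentiable_on UNIV"
    using \<phi> unfolding test_function_def by blast+
  then have d: "\<phi> differentiable_on UNIV" and "deriv \<phi> differentiable_on UNIV"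
    by simp_all
  then have c\<phi>': "isCont (deriv \<phi>) x" for x
    by (metis UNIV_I continuous_on_eq_continuous_at open_UNIV differentiable_imp_continuous_on)
  have der\<phi>: "(\<phi> has_real_derivative deriv \<phi> x) (at x)" for x
    using d by (simp add: DERIV_deriv_iff_real_differentiable differentiable_on_def)
  define K where "K = closure {x. \<phi> x \<noteq> 0}"
  have "compact K"
    using \<phi> by (simp add: test_function_def K_def)
  then obtain A where A: "\<And>x. x \<in> K \<Longrightarrow> \<bar>x\<bar> \<le> A"
    using compact_imp_bounded bounded_iff by (metis real_norm_def)
  \<comment> \<open>The added 1 puts \<open>B\<close> and \<open>- B\<close> strictly outside the
    support, so both boundary terms vanish.\<close>
  define B where "B = max A 0 + 1"
  have \<phi>0: "\<phi> x = 0" if "x \<notin> K" for x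
    using that closure_subset[of "{x. \<phi> x \<noteq> 0}"] by (auto simp: K_def)
  have \<phi>'0: "deriv \<phi> x = 0" if "x \<notin> K" for x
  proof -
    have "(\<phi> has_real_derivative 0) (at x)"
    proof (rule has_field_derivative_transform_within_open)
      show "((\<lambda>_. 0) has_real_derivative 0) (at x)" by simp
      show "open (- K)"
        by (simp add: K_def open_Compl)
    qed (use that \<phi>0 in auto)
    then show ?thesis
      by (rule DERIV_imp_deriv)
  qed
  have out: "x \<notin> K" if "x \<notin> {-B..B}" for x
    using A[of x] that unfolding B_def by force
  have B0: "\<phi> B = 0" "\<phi> (- B) = 0" "-B \<le> B"
    using A[of B] A[of "-B"] \<phi>0 unfolding B_def by fastforce+
  have cf: "isCont f x" for x
    using der DERIV_isCont by blast
  have cf': "isCont f' x" for x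
    using cont by (simp add: continuous_on_eq_continuous_at)
  have c\<phi>: "isCont \<phi> x" for x
    using der\<phi> DERIV_isCont by blast
  have int: "integrable lebesgue g" if g: "\<And>x. isCont g x" "\<And>x. x \<notin> {-B..B} \<Longrightarrow> g x = 0"
    for g :: "real \<Rightarrow> real"
  proof -
    have "g absolutely_integrable_on {-B..B}"
      by (rule absolutely_integrable_continuous_real)
        (use g in \<open>simp add: continuous_at_imp_continuous_on\<close>)
    moreover have "(\<lambda>x. indicat_real {-B..B} x *\<^sub>R g x) = g"
      using g(2) by (auto simp: indicator_def fun_eq_iff)
    ultimately show ?thesis
      by (simp add: set_integrable_def)
  qed
  have i1: "integrable lebesgue (\<lambda>x. f x * deriv \<phi> x)"
    using out \<phi>'0 by (intro int continuous_intros cf c\<phi>') auto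
  have i2: "integrable lebesgue (\<lambda>x. f' x * \<phi> x)"
    using out \<phi>0 by (intro int continuous_intros cf' c\<phi>) auto
  let ?g = "\<lambda>x. f x * deriv \<phi> x + f' x * \<phi> x"
  have "(?g has_integral (f B * \<phi> B - f (-B) * \<phi> (-B))) {-B..B}"
  proof (rule fundamental_theorem_of_calculus[OF B0(3)])
    fix x
    have "((\<lambda>x. f x * \<phi> x) has_real_derivative ?g x) (at x within {-B..B})"
      by (rule DERIV_subset[OF DERIV_cong[OF DERIV_mult[OF der der\<phi>]]]) auto
    then show "((\<lambda>x. f x * \<phi> x) has_vector_derivative ?g x) (at x within {-B..B})"
      by (simp add: has_real_derivative_iff_has_vector_derivative)
  qed
  then have "(?g has_integral 0) {-B..B}"
    by (simp add: B0)
  then have "(?g has_integral 0) UNIV"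
    by (rule has_integral_on_superset) (use out \<phi>0 \<phi>'0 in auto)
  moreover have "(?g has_integral integral\<^sup>L lebesgue ?g) UNIV"
    by (rule has_integral_integral_lebesgue) (intro Bochner_Integration.integrable_add i1 i2)
  ultimately have "integral\<^sup>L lebesgue ?g = 0"
    using has_integral_unique by blast
  then show "integral\<^sup>L lebesgue (\<lambda>x. f x * deriv \<phi> x) = - integral\<^sup>L lebesgue (\<lambda>x. f' x * \<phi> x)"
    using Bochner_Integration.integral_add[OF i1 i2] by simp
qed

section \<open>Homoclinic orbits\<close>

text \<open>A positive derivative gives strict monotonicity and hence an inverse. It serves twice:
  to turn the time map of the orbit into \<open>S\<close>, and to solve the cubic constraint for
  \<open>V\<close>.\<close>

lemma increasing_inverse:
  fixes f f' :: "real \<Rightarrow> real"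
  assumes der: "\<And>x. x \<in> S \<Longrightarrow> (f has_real_derivative f' x) (at x)"
    and pos: "\<And>x. x \<in> S \<Longrightarrow> f' x > 0"
    and S: "open S" "is_interval S"
  obtains g where "\<And>x. x \<in> S \<Longrightarrow> g (f x) = x"
    "\<And>y. y \<in> f ` S \<Longrightarrow> g y \<in> S" "\<And>y. y \<in> f ` S \<Longrightarrow> f (g y) = y"
    "\<And>y. y \<in> f ` S \<Longrightarrow> (g has_real_derivative inverse (f' (g y))) (at y)"
    "\<And>y z. y \<in> f ` S \<Longrightarrow> z \<in> f ` S \<Longrightarrow> y < z \<Longrightarrow> g y < g z"
proof -
  have mono: "f x < f y" if "x \<in> S" "y \<in> S" "x < y" for x y
  proof (rule DERIV_pos_imp_increasing[OF \<open>x < y\<close>])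
    fix z assume "x \<le> z" "z \<le> y"
    then have "z \<in> S"
      using S(2) that unfolding is_interval_1 by blast
    then show "\<exists>d. (f has_real_derivative d) (at z) \<and> d > 0"
      using der pos by blast
  qed
  have inj: "inj_on f S"
    by (rule inj_onI) (metis mono less_irrefl linorder_neqE)
  define g where "g = the_inv_into S f"
  have gf: "g (f x) = x" if "x \<in> S" for x
    using that inj by (simp add: g_def the_inv_into_f_f)
  have gS: "g y \<in> S" and fg: "f (g y) = y" if "y \<in> f ` S" for y
    using that gf by auto
  have cont: "continuous_on S f"
    using der DERIV_isCont by (blast intro: continuous_at_imp_continuous_on)
  show thesis
  proof
    show "(g has_real_derivative inverse (f' (g y))) (at y)" if "y \<in> f ` S" for y
      using has_field_derivative_inverse_strong_x[OF der _ S(1) cont gS fg gf] pos[OF gS[OF that]] gS that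
      by (metis less_irrefl)
    show "g y < g z" if "y \<in> f ` S" "z \<in> f ` S" "y < z" for y z
      using mono fg gS that by (metis less_asym linorder_less_linear)
  qed (use gf gS fg in auto)
qed

text \<open>The inequality \<open>p M < 0\<close> makes \<open>M\<close> a simple zero of
  \<open>P\<close>, which is a regular turning point. The upper bound in \<open>near0\<close> makes
  the travel time towards 0 infinite, so the orbit lives on the whole line; the lower bound forces
  exponential decay.\<close>

lemma homoclinic_orbit:
  fixes P p :: "real \<Rightarrow> real"
  assumes M: "M > 0"
    and der: "\<And>u. 0 < u \<Longrightarrow> u \<le> M \<Longrightarrow> (P has_real_derivative p u) (at u)"
    and pos: "\<And>u. 0 < u \<Longrightarrow> u < M \<Longrightarrow> P u > 0"
    and PM: "P M = 0" and pM: "p M < 0"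
    and kC: "\<delta> > 0" "k > 0" "C > 0"
    and near0: "\<And>u. 0 < u \<Longrightarrow> u < \<delta> \<Longrightarrow> (k * u)\<^sup>2 \<le> P u \<and> P u \<le> (C * u)\<^sup>2"
  obtains U U' where
    "\<And>x. (U has_real_derivative U' x) (at x)"
    "\<And>x. (U' has_real_derivative p (U x) / 2) (at x)"
    "\<And>x. 0 < U x \<and> U x \<le> M"
    "\<And>x. U (- x) = U x"
    "\<And>x y. \<bar>x\<bar> \<le> \<bar>y\<bar> \<Longrightarrow> U y \<le> U x"
    "square_integrable U" "square_integrable U'"
proof -
  \<comment> \<open>\<open>R\<close> is the quotient of \<open>P\<close> by its simple zero at
    \<open>M\<close>, filled in by its limit there. It is continuous and positive up to and
    including \<open>M\<close>.\<close>
  define R where "R u = (if u = M then - p M else P u / (M - u))" for u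
  have Rcont: "isCont R u" if u: "0 < u" "u \<le> M" for u
  proof (cases "u = M")
    case True
    have "((\<lambda>v. - ((P v - P M) / (v - M))) \<longlongrightarrow> - p M) (at M)"
      using der[OF M order_refl] by (intro tendsto_minus) (simp add: has_field_derivative_iff)
    then have "(R \<longlongrightarrow> - p M) (at M)"
    proof (rule Lim_transform_eventually)
      have "- ((P v - P M) / (v - M)) = R v" if "v \<noteq> M" for v
        using that by (simp add: R_def PM field_simps)
      then show "\<forall>\<^sub>F v in at M. - ((P v - P M) / (v - M)) = R v"
        by (auto simp: eventually_at_filter)
    qed
    then show ?thesis
      by (simp add: True isCont_def R_def)
  next
    case False
    have "isCont (\<lambda>v. P v / (M - v)) u"
      using False DERIV_isCont[OF der[OF u]] by (intro continuous_intros) auto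
    moreover have "\<forall>\<^sub>F v in nhds u. R v = P v / (M - v)"
      using t1_space_nhds[OF False] by eventually_elim (simp add: R_def)
    ultimately show ?thesis
      using isCont_cong[of R "\<lambda>v. P v / (M - v)" u] by simp
  qed
  have Rpos: "R u > 0" if "0 < u" "u \<le> M" for u
    using that pos[of u] pM by (auto simp: R_def)
  have RP: "(M - u) * R u = P u" for u
    by (simp add: R_def PM)
  \<comment> \<open>\<open>g\<close> is \<open>2 * \<bar>s\<bar> / sqrt (P (M - s\<^sup>2))\<close>, extended continuously to \<open>s = 0\<close>.\<close>
  define r where "r = sqrt M"
  define g where "g s = 2 / sqrt (R (M - s\<^sup>2))" for s
  have r0: "r > 0"
    using M by (simp add: r_def)
  have us: "0 < M - s\<^sup>2" "M - s\<^sup>2 \<le> M" if "-r < s" "s < r" for s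
  proof -
    have "s\<^sup>2 < r\<^sup>2"
      using that r0 by (intro power2_strict_mono) auto
    then show "0 < M - s\<^sup>2" "M - s\<^sup>2 \<le> M"
      using M by (auto simp: r_def)
  qed
  have sqrtR: "sqrt (R (M - s\<^sup>2)) > 0" if "-r < s" "s < r" for s
    using Rpos us[OF that] by simp
  have gcont: "isCont g s" if "-r < s" "s < r" for s
    unfolding g_def using us[OF that] sqrtR[OF that]
    by (intro continuous_intros isCont_o2[OF _ Rcont]) auto
  have gpos: "g s > 0" if "-r < s" "s < r" for s
    using sqrtR[OF that] by (simp add: g_def)
  obtain F where F: "\<And>s. -r < s \<Longrightarrow> s < r \<Longrightarrow> (F has_real_derivative g s) (at s)"
    using einterval_antiderivative[of "ereal (-r)" "ereal r" g] gcont r0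
    by (auto simp: has_real_derivative_iff_has_vector_derivative)
  \<comment> \<open>Since \<open>g\<close> is even, the odd part of \<open>F\<close> is again a
    primitive of \<open>g\<close>. Oddness of \<open>T\<close> is what makes \<open>U\<close> even
    with its maximum at 0.\<close>
  define T where "T s = (F s - F (- s)) / 2" for s
  have Todd: "T (- s) = - T s" for s
    by (simp add: T_def field_simps)
  have Tder: "(T has_real_derivative g s) (at s)" if s: "-r < s" "s < r" for s
  proof -
    have "((\<lambda>s. F (- s)) has_real_derivative g (- s) * (- 1)) (at s)"
      by (rule DERIV_chain2[OF F]) (use s in \<open>auto intro!: derivative_eq_intros\<close>)
    then have "(T has_real_derivative (g s - g (- s) * (- 1)) / 2) (at s)"
      unfolding T_def by (intro DERIV_cdivide DERIV_diff F[OF s])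
    then show ?thesis
      by (simp add: g_def)
  qed
  have Tcont: "continuous_on {-r<..<r} T"
    by (rule continuous_at_imp_continuous_on) (use DERIV_isCont[OF Tder] in auto)
  have Tlarge: "\<exists>s. 0 < s \<and> s < r \<and> y \<le> T s" for y
  proof -
    define d where "d = min \<delta> M / 2"
    have d: "0 < d" "d < \<delta>" "d < M"
      using kC M by (auto simp: d_def)
    define s0 where "s0 = sqrt (M - d)"
    have s0: "0 < s0" "s0 < r" "M - s0\<^sup>2 = d"
      using d by (auto simp: s0_def r_def)
    \<comment> \<open>Near \<open>r\<close> the derivative of \<open>T\<close> dominates that of \<open>- ln (M - s\<^sup>2) / C\<close>.\<close>
    define L where "L s = T s + ln (M - s\<^sup>2) / C" for s
    have L: "L s0 \<le> L s" if s: "s0 \<le> s" "s < r" for s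
    proof (rule DERIV_nonneg_imp_nondecreasing[OF s(1)])
      fix t assume t: "s0 \<le> t" "t \<le> s"
      define u where "u = M - t\<^sup>2"
      have tr: "-r < t" "t < r"
        using t s s0 r0 by linarith+
      have u: "0 < u" "u \<le> M"
        using us[OF tr] by (auto simp: u_def)
      have "s0\<^sup>2 \<le> t\<^sup>2"
        using t s0 by (intro power_mono) auto
      then have ud: "u < \<delta>"
        using s0(3) d by (simp add: u_def)
      have "(t * sqrt (R u))\<^sup>2 = P u"
        using Rpos[OF u] RP[of u] by (simp add: power_mult_distrib u_def)
      also have "\<dots> \<le> (C * u)\<^sup>2"
        using near0[OF u(1) ud] by simp
      finally have "t * sqrt (R u) \<le> C * u"
        using kC u by (intro power2_le_imp_le[of "t * sqrt (R u)"]) auto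
      moreover have "sqrt (R u) > 0" "u * C > 0"
        using Rpos[OF u] u kC by auto
      ultimately have "2 * t / (u * C) \<le> 2 / sqrt (R u)"
        by (simp add: field_simps)
      then have "2 * t / (u * C) \<le> g t"
        by (simp add: g_def u_def)
      moreover have "(L has_real_derivative g t + (1 / u * (- 2 * t)) / C) (at t)"
        unfolding L_def u_def using u kC
        by (auto intro!: derivative_eq_intros Tder tr simp: u_def)
      ultimately show "\<exists>z. (L has_real_derivative z) (at t) \<and> 0 \<le> z"
        by (intro exI[of _ "g t + (1 / u * (- 2 * t)) / C"]) (simp add: field_simps)
    qed
    \<comment> \<open>The exponential is the solution of \<open>ln u = C * (L s0 - y)\<close>. At
      the corresponding \<open>s\<close>, monotonicity of \<open>L\<close> gives
      \<open>T s \<ge> L s0 - ln u / C \<ge> y\<close>; the cap \<open>d\<close> ensures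
      \<open>s \<ge> s0\<close>.\<close>
    define u where "u = min d (exp (C * (L s0 - y)))"
    have u: "0 < u" "u \<le> d"
      using d by (auto simp: u_def)
    define s where "s = sqrt (M - u)"
    have s: "s0 \<le> s" "s < r" "M - s\<^sup>2 = u"
      using u d by (auto simp: s_def s0_def r_def)
    have "u \<le> exp (C * (L s0 - y))"
      by (simp add: u_def)
    then have "ln u \<le> C * (L s0 - y)"
      using u ln_le_cancel_iff[of u "exp (C * (L s0 - y))"] by simp
    then have "ln u / C \<le> L s0 - y"
      using kC by (simp add: field_simps)
    with L[OF s(1,2)] have "y \<le> T s"
      by (simp add: L_def s(3))
    with s s0 show ?thesis
      by (intro exI[of _ s]) auto
  qed
  have Tsurj: "T ` {-r<..<r} = UNIV"
  proof -
    have "y \<in> T ` {-r<..<r}" for y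
    proof -
      obtain s where s: "0 < s" "s < r" "\<bar>y\<bar> \<le> T s"
        using Tlarge by blast
      have "\<exists>t\<ge>-s. t \<le> s \<and> T t = y"
        using s by (intro IVT') (auto simp: Todd intro: continuous_on_subset[OF Tcont])
      then show ?thesis
        using s by force
    qed
    then show ?thesis by blast
  qed
  obtain S where S_raw: "\<And>s. s \<in> {-r<..<r} \<Longrightarrow> S (T s) = s"
    "\<And>x. x \<in> T ` {-r<..<r} \<Longrightarrow> S x \<in> {-r<..<r}" "\<And>x. x \<in> T ` {-r<..<r} \<Longrightarrow> T (S x) = x"
    "\<And>x. x \<in> T ` {-r<..<r} \<Longrightarrow> (S has_real_derivative inverse (g (S x))) (at x)"
    "\<And>x y. x \<in> T ` {-r<..<r} \<Longrightarrow> y \<in> T ` {-r<..<r} \<Longrightarrow> x < y \<Longrightarrow> S x < S y"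
    by (rule increasing_inverse[of "{-r<..<r}" T g]) (use Tder gpos in \<open>auto simp: is_interval_1\<close>)
  note S_UNIV = S_raw(2-)[unfolded Tsurj, OF UNIV_I]
  have ST: "S (T s) = s" if "-r < s" "s < r" for s
    using S_raw(1) that by simp
  have S: "-r < S x" "S x < r" for x
    using S_UNIV(1)[of x] by auto
  note TS = S_UNIV(2) and Sder = S_UNIV(3) and Smono = S_UNIV(4)[OF UNIV_I]
  have Sodd: "S (- x) = - S x" for x
    using ST[of "- S x"] S[of x] by (simp add: Todd TS)
  have S0: "S 0 = 0"
    using Sodd[of 0] by simp
  define U where "U x = M - (S x)\<^sup>2" for x
  define Q where "Q x = sqrt (R (U x))" for x
  \<comment> \<open>This is \<open>- 2 * S * S'\<close> with \<open>S' = Q / 2\<close>, because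
    \<open>g\<close> at \<open>S x\<close> equals \<open>2 / Q x\<close>.\<close>
  define U' where "U' x = - S x * Q x" for x
  have U: "0 < U x" "U x \<le> M" for x
    using us[OF S[of x]] by (auto simp: U_def)
  have Q: "Q x > 0" for x
    using Rpos[OF U] by (simp add: Q_def)
  have Sder': "(S has_real_derivative Q x / 2) (at x)" for x
    using Sder[of x] by (simp add: g_def Q_def U_def)
  have Uder: "(U has_real_derivative U' x) (at x)" for x
    unfolding U_def U'_def by (auto intro!: derivative_eq_intros Sder')
  have Ucont: "isCont U x" for x
    using Uder DERIV_isCont by blast
  have Qcont: "isCont Q x" for x
    unfolding Q_def by (intro continuous_intros isCont_o2[OF Ucont Rcont] U)
  have Scont: "isCont S x" for x
    using Sder DERIV_isCont by blast
  have U'cont: "isCont U' x" for x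
    unfolding U'_def by (intro continuous_intros Scont Qcont)
  \<comment> \<open>Conservation of energy at level zero: the square of \<open>S x\<close> is
    \<open>M - U x\<close>, which turns \<open>R\<close> back into \<open>P\<close>.\<close>
  have U'sq: "(U' x)\<^sup>2 = P (U x)" for x
    using Rpos[OF U] RP[of "U x"] by (simp add: U'_def Q_def power_mult_distrib less_imp_le) (simp add: U_def)
  have U'der: "(U' has_real_derivative p (U x) / 2) (at x)" for x
  proof (cases "x = 0")
    case True
    \<comment> \<open>At the maximum \<open>P (U x)\<close> vanishes and the square root is not
      differentiable, so the difference quotient is computed directly. Its limit is
      \<open>- R M / 2 = p M / 2\<close>.\<close>
    have "((\<lambda>h. - ((S (0 + h) - S 0) / h) * Q h) \<longlongrightarrow> - (Q 0 / 2) * Q 0) (at 0)"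
      using Sder'[of 0] Qcont[of 0]
      by (intro tendsto_mult tendsto_minus) (simp_all add: DERIV_def isCont_def)
    then have "((\<lambda>h. (U' (0 + h) - U' 0) / h) \<longlongrightarrow> p (U 0) / 2) (at 0)"
      using pM by (simp add: U'_def S0 Q_def U_def R_def)
    then show ?thesis
      by (simp add: True DERIV_def)
  next
    case False
    \<comment> \<open>Away from \<open>0\<close>, differentiate \<open>U' = \<plusminus> sqrt (P U)\<close>.\<close>
    have Sx: "S x \<noteq> 0"
      using ST[of "S x"] TS[of x] False Todd[of 0] by fastforce
    then have SxSx: "S x * S x > 0"
      by (metis not_real_square_gt_zero)
    have Plt: "P (U x) > 0"
      using Sx U[of x] by (intro pos) (auto simp: U_def)
    define e where "e = - sgn (S x)"
    have e: "e * e = 1"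
      using Sx by (simp add: e_def sgn_if)
    have eU': "U' z = e * sqrt (P (U z))" if "S z * S x > 0" for z
    proof -
      have "U' z = e * \<bar>U' z\<bar>"
        using that Q[of z] by (auto simp: e_def U'_def sgn_if abs_mult zero_less_mult_iff)
      then show ?thesis
        by (simp flip: U'sq)
    qed
    have dP: "((\<lambda>z. P (U z)) has_real_derivative p (U x) * U' x) (at x)"
      by (rule DERIV_chain2[OF der[OF U] Uder])
    have "((\<lambda>z. e * sqrt (P (U z))) has_real_derivative
        e * ((p (U x) * U' x) * (inverse (sqrt (P (U x))) / 2))) (at x)"
      by (rule DERIV_cmult[OF DERIV_cong[OF DERIV_chain2[OF DERIV_real_sqrt[OF Plt] dP]]]) simp
    also have "e * ((p (U x) * U' x) * (inverse (sqrt (P (U x))) / 2)) = p (U x) / 2"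
      using Plt e eU'[OF SxSx] by (simp add: field_simps)
    finally have *: "((\<lambda>z. e * sqrt (P (U z))) has_real_derivative p (U x) / 2) (at x)" .
    have op: "open {z. S z * S x > 0}"
      by (intro open_Collect_less continuous_intros continuous_at_imp_continuous_on ballI Scont)
    show ?thesis
      by (rule has_field_derivative_transform_within_open[OF * op])
        (use SxSx eU' in auto)
  qed
  have Sabs: "\<bar>S x\<bar> = S \<bar>x\<bar>" for x
    using Smono[of 0 x] Smono[of x 0] S0 Sodd[of x] by (cases "x < 0"; cases "x = 0") auto
  have Udec: "U y \<le> U x" if "\<bar>x\<bar> \<le> \<bar>y\<bar>" for x y
  proof -
    have "\<bar>S x\<bar> \<le> \<bar>S y\<bar>"
      using that Smono[of "\<bar>x\<bar>" "\<bar>y\<bar>"] by (cases "\<bar>x\<bar> = \<bar>y\<bar>") (auto simp: Sabs)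
    then show ?thesis
      by (simp add: U_def abs_le_square_iff)
  qed
  have Ueven: "U (- x) = U x" for x
    by (simp add: U_def Sodd)
  \<comment> \<open>\<open>X\<close> is the time at which the orbit has come down to height
    \<open>d < \<delta>\<close>; from there on the bounds \<open>near0\<close> apply.\<close>
  obtain X where X: "X > 0" "U X < \<delta>"
  proof -
    define d where "d = min \<delta> M / 2"
    have d: "0 < d" "d < \<delta>" "d < M"
      using kC M by (auto simp: d_def)
    define q where "q = sqrt (M - d)"
    have q: "0 < q" "q < r"
      using d by (auto simp: q_def r_def)
    then have STq: "S (T q) = q"
      using ST[of q] by simp
    have "U (T q) = d"
      using STq d by (simp add: U_def q_def)
    moreover have "T q > 0"
      using Smono[of "T q" 0] q STq S0 by (cases "T q" "0::real" rule: linorder_cases) auto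
    ultimately show thesis
      using that d by auto
  qed
  have Uneg: "U' x \<le> - k * U x \<and> \<bar>U' x\<bar> \<le> C * U x" if "x \<ge> X" for x
  proof -
    have "U x < \<delta>"
      using Udec[of X x] X that by simp
    then have *: "(k * U x)\<^sup>2 \<le> (U' x)\<^sup>2" "(U' x)\<^sup>2 \<le> (C * U x)\<^sup>2"
      using near0 U[of x] by (auto simp: U'sq)
    have "U' x \<le> 0"
      using Smono[of 0 x] S0 X that mult_pos_pos[of "S x" "Q x"] Q[of x] by (simp add: U'_def)
    moreover have "k * U x \<le> \<bar>U' x\<bar>"
      by (rule power2_le_imp_le) (simp_all add: *(1))
    moreover have "\<bar>U' x\<bar> \<le> C * U x"
      by (rule power2_le_imp_le) (use *(2) kC U(1)[of x] in simp_all)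
    ultimately show ?thesis by linarith
  qed
  define K where "K = U X * exp (k * X)"
  have decay: "U x \<le> K * exp (- k * \<bar>x\<bar>)" if "\<bar>x\<bar> \<ge> X" for x
  proof -
    \<comment> \<open>The inequality \<open>U' \<le> - k * U\<close> says that
      \<open>U t * exp (k * t)\<close> does not increase beyond \<open>X\<close>.\<close>
    have "U X * exp (k * X) \<ge> U \<bar>x\<bar> * exp (k * \<bar>x\<bar>)"
    proof (rule DERIV_nonpos_imp_nonincreasing[OF that])
      fix t assume t: "X \<le> t"
      have "((\<lambda>t. U t * exp (k * t)) has_real_derivative (U' t + k * U t) * exp (k * t)) (at t)"
        by (auto intro!: derivative_eq_intros Uder simp: algebra_simps)
      moreover have "(U' t + k * U t) * exp (k * t) \<le> 0"
        using Uneg[OF t] by (simp add: mult_le_0_iff)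
      ultimately show "\<exists>z. ((\<lambda>t. U t * exp (k * t)) has_real_derivative z) (at t) \<and> z \<le> 0"
        by blast
    qed
    moreover have "U \<bar>x\<bar> = U x"
      using Ueven by (cases "x < 0") auto
    ultimately show ?thesis
      by (simp add: K_def exp_minus field_simps)
  qed
  have decay': "\<bar>U' x\<bar> \<le> C * K * exp (- k * \<bar>x\<bar>)" if "\<bar>x\<bar> \<ge> X" for x
  proof -
    have "\<bar>U' x\<bar> = \<bar>U' \<bar>x\<bar>\<bar>"
      by (cases "x < 0") (auto simp: U'_def Q_def Ueven Sodd)
    also have "\<dots> \<le> C * U \<bar>x\<bar>"
      using Uneg[OF that] by blast
    also have "\<dots> \<le> C * (K * exp (- k * \<bar>x\<bar>))"
      using decay[of "\<bar>x\<bar>"] that kC by (intro mult_left_mono) auto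
    finally show ?thesis by (simp add: mult.assoc)
  qed
  show thesis
  proof
    show "square_integrable U"
    proof (rule square_integrable_exp_decay[OF _ kC(2)])
      show "continuous_on UNIV U"
        by (rule continuous_at_imp_continuous_on) (simp add: Ucont)
      show "\<bar>U x\<bar> \<le> K * exp (- k * \<bar>x\<bar>)" if "X \<le> \<bar>x\<bar>" for x
        using decay[OF that] U(1)[of x] by linarith
    qed
    show "square_integrable U'"
    proof (rule square_integrable_exp_decay[OF _ kC(2) decay'])
      show "continuous_on UNIV U'"
        by (rule continuous_at_imp_continuous_on) (simp add: U'cont)
    qed
  qed (use Uder U'der U Ueven Udec in auto)
qed

section \<open>Solutions on a branch of the constraint\<close>

text \<open>Monotonicity on \<open>(0, m]\<close> compares \<open>f m\<close> with values near 0.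
  Only the one-sided limit enters, since the branches are controlled for positive arguments
  alone.\<close>

lemma nonneg_of_deriv_nonneg_at_right_0:
  fixes f :: "real \<Rightarrow> real"
  assumes "m > 0" and lim: "(f \<longlongrightarrow> 0) (at_right 0)"
    and der: "\<And>u. 0 < u \<Longrightarrow> u \<le> m \<Longrightarrow> (f has_real_derivative d u) (at u) \<and> d u \<ge> 0"
  shows "f m \<ge> 0"
proof (rule tendsto_upperbound[OF lim])
  have "f u \<le> f m" if "0 < u" "u \<le> m" for u
  proof (rule DERIV_nonneg_imp_nondecreasing[OF that(2)])
    show "\<exists>y. (f has_real_derivative y) (at z) \<and> y \<ge> 0" if "u \<le> z" "z \<le> m" for z
      using der[of z] that \<open>0 < u\<close> by auto
  qed
  then show "\<forall>\<^sub>F u in at_right 0. f u \<le> f m"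
    by (auto simp: eventually_at_right_field intro!: exI[of _ m] assms(1))
qed simp

text \<open>The constraint makes the two sides of the second equation derivatives of the same
  function, so only the scalar equation for \<open>U\<close> is left. The point \<open>m\<close>
  guarantees a first zero of \<open>P\<close> inside the domain of the branch, and
  \<open>transversal\<close> makes that zero simple.\<close>

lemma solution_on_branch:
  fixes v v' \<Psi> :: "real \<Rightarrow> real" and \<alpha> \<rho> :: real
  defines "P \<equiv> \<lambda>u. \<alpha> * \<rho> * u\<^sup>2 + \<alpha> * \<Psi> u - u ^ 4 / 2"
  assumes pos: "\<alpha> > 0" "\<rho> > 0"
    and dv: "\<And>u. 0 < u \<Longrightarrow> u < L \<Longrightarrow> (v has_real_derivative v' u) (at u)"
    and cv': "\<And>u. 0 < u \<Longrightarrow> u < L \<Longrightarrow> isCont v' u"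
    and v0: "(v \<longlongrightarrow> 0) (at_right 0)"
    and d\<Psi>: "\<And>u. 0 < u \<Longrightarrow> u < L \<Longrightarrow> (\<Psi> has_real_derivative 2 * u * v u) (at u)"
    and \<Psi>0: "(\<Psi> \<longlongrightarrow> 0) (at_right 0)"
    and m: "0 < m" "m < L" "P m \<le> 0"
    and transversal: "\<And>u. 0 < u \<Longrightarrow> u \<le> m \<Longrightarrow> P u = 0 \<Longrightarrow> v u * u\<^sup>2 < \<rho> * u\<^sup>2 + 2 * \<Psi> u"
    and branch: "\<And>u. 0 < u \<Longrightarrow> u < L \<Longrightarrow> a * (v u)\<^sup>2 - b * v u ^ 3 = \<alpha> * u\<^sup>2"
  obtains U where "solves_S \<rho> a b \<alpha> U (\<lambda>x. v (U x))" "U \<in> H1_rd"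
    "\<And>x. 0 < U x" "\<And>x. U x < L"
proof -
  \<comment> \<open>\<open>p\<close> is the derivative of \<open>P\<close>, factored so that
    \<open>U'' = p U / 2\<close> is visibly the first equation of the system.\<close>
  define p where "p u = 2 * u * (\<alpha> * (\<rho> + v u) - u\<^sup>2)" for u
  have dP: "(P has_real_derivative p u) (at u)" if "0 < u" "u < L" for u
    unfolding P_def p_def
    by (auto intro!: derivative_eq_intros d\<Psi> that simp: algebra_simps power2_eq_square power3_eq_cube)
  have cP: "isCont P u" if "0 < u" "u < L" for u
    using dP[OF that] DERIV_isCont by blast
  have L0: "L > 0"
    using m by simp
  have near: "\<forall>\<^sub>F u in at_right 0. 0 < u \<and> u < L"
    using L0 by (auto simp: eventually_at_right_field intro!: exI[of _ L])
  \<comment> \<open>As \<open>v\<close> tends to 0, \<open>\<Psi>\<close> is of smaller order than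
    the square of \<open>u\<close>. Hence \<open>P\<close> behaves like
    \<open>\<alpha> * \<rho> * u\<^sup>2\<close> near 0, with two-sided bounds having factors 1/2
    and 2.\<close>
  have "((\<lambda>u. \<Psi> u / u\<^sup>2) \<longlongrightarrow> 0) (at_right 0)"
  proof (rule lhopital_right_0[OF \<Psi>0, where g' = "\<lambda>u. 2 * u" and f' = "\<lambda>u. 2 * u * v u"])
    show "((\<lambda>u::real. u\<^sup>2) \<longlongrightarrow> 0) (at_right 0)"
      by (auto intro!: tendsto_eq_intros)
    show "((\<lambda>u. 2 * u * v u / (2 * u)) \<longlongrightarrow> 0) (at_right 0)"
      using v0 by (rule Lim_transform_eventually) (use near in \<open>eventually_elim, simp\<close>)
    show "\<forall>\<^sub>F u::real in at_right 0. u\<^sup>2 \<noteq> 0" "\<forall>\<^sub>F u::real in at_right 0. 2 * u \<noteq> 0"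
      using near by (eventually_elim, simp)+
    show "\<forall>\<^sub>F u in at_right 0. (\<Psi> has_real_derivative 2 * u * v u) (at u)"
      using near by eventually_elim (simp add: d\<Psi>)
    show "\<forall>\<^sub>F u::real in at_right 0. ((\<lambda>u. u\<^sup>2) has_real_derivative 2 * u) (at u)"
      by (intro always_eventually allI) (auto intro!: derivative_eq_intros)
  qed
  then have "((\<lambda>u. \<alpha> * \<rho> + \<alpha> * (\<Psi> u / u\<^sup>2) - u\<^sup>2 / 2) \<longlongrightarrow> \<alpha> * \<rho> + \<alpha> * 0 - 0\<^sup>2 / 2)
      (at_right 0)"
    by (intro tendsto_intros) simp_all
  then have lim: "((\<lambda>u. P u / u\<^sup>2) \<longlongrightarrow> \<alpha> * \<rho>) (at_right 0)"
    unfolding mult_zero_right power_zero_numeral div_0 add_0_right diff_0_right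
    by (rule Lim_transform_eventually)
      (use near in \<open>eventually_elim, simp add: P_def field_simps power2_eq_square power4_eq_xxxx\<close>)
  have \<alpha>\<rho>: "\<alpha> * \<rho> > 0"
    using pos by simp
  have "\<forall>\<^sub>F u in at_right 0. \<alpha> * \<rho> / 2 < P u / u\<^sup>2 \<and> P u / u\<^sup>2 < 2 * (\<alpha> * \<rho>)"
    using order_tendstoD(1)[OF lim, of "\<alpha> * \<rho> / 2"] order_tendstoD(2)[OF lim, of "2 * (\<alpha> * \<rho>)"] \<alpha>\<rho>
    by (auto intro: eventually_conj)
  then obtain \<delta> where \<delta>: "\<delta> > 0"
    and P\<delta>: "\<And>u. 0 < u \<Longrightarrow> u < \<delta> \<Longrightarrow> \<alpha> * \<rho> / 2 < P u / u\<^sup>2 \<and> P u / u\<^sup>2 < 2 * (\<alpha> * \<rho>)"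
    by (auto simp: eventually_at_right_field)
  have Psmall: "\<alpha> * \<rho> / 2 * u\<^sup>2 < P u" "P u < 2 * (\<alpha> * \<rho>) * u\<^sup>2" if "0 < u" "u < \<delta>" for u
    using P\<delta>[OF that] that by (auto simp: field_simps)
  have Ppos: "P u > 0" if "0 < u" "u < \<delta>" for u
  proof -
    have "\<alpha> * \<rho> / 2 * u\<^sup>2 > 0"
      using \<alpha>\<rho> that by simp
    with Psmall[OF that] show ?thesis by linarith
  qed
  have \<delta>m: "\<delta> \<le> m"
    using Ppos[of m] m by linarith
  \<comment> \<open>Since \<open>P\<close> is positive below \<open>\<delta>\<close>, starting at
    \<open>\<delta>/2\<close> loses no zero and keeps the set compact and away from 0.\<close>
  define Z where "Z = {\<delta>/2..m} \<inter> {u. P u \<le> 0}"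
  have contP: "continuous_on {\<delta>/2..m} P"
    by (rule continuous_at_imp_continuous_on) (use cP \<delta> m in auto)
  have "Z = {\<delta>/2..m} \<inter> P -` {..0}"
    by (auto simp: Z_def)
  moreover have "closed \<dots>"
    by (rule continuous_closed_preimage[OF contP]) auto
  ultimately have "compact Z"
    using compact_Int_closed[of "{\<delta>/2..m}" Z] by (simp add: Z_def Int_absorb)
  moreover have "m \<in> Z"
    using m \<delta>m \<delta> by (auto simp: Z_def)
  ultimately obtain M where M: "M \<in> Z" and Mmin: "\<And>u. u \<in> Z \<Longrightarrow> M \<le> u"
    using compact_attains_inf[of Z] by blast
  have M0: "M > 0" "M \<le> m"
    using M \<delta> by (auto simp: Z_def)
  \<comment> \<open>\<open>P\<close> changes sign between \<open>\<delta>/2\<close> and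
    \<open>M\<close>; the zero found there lies in \<open>Z\<close>, so by minimality it is
    \<open>M\<close>.\<close>
  have PM: "P M = 0"
  proof -
    have "\<exists>x\<ge>\<delta>/2. x \<le> M \<and> P x = 0"
      using M Ppos[of "\<delta>/2"] \<delta>
      by (intro IVT2') (auto simp: Z_def intro: continuous_on_subset[OF contP])
    then show ?thesis
      using Mmin M0 by (force simp: Z_def)
  qed
  have Ppos': "P u > 0" if "0 < u" "u < M" for u
  proof (cases "u < \<delta>")
    case False
    then show ?thesis
      using Mmin[of u] that M0 \<delta> by (force simp: Z_def)
  qed (use Ppos that in auto)
  \<comment> \<open>Adding \<open>\<alpha> * \<rho> * M\<^sup>2\<close> to \<alpha> times the
    transversality inequality turns its right side into \<open>M ^ 4\<close>, by
    \<open>P M = 0\<close>.\<close>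
  have pM: "p M < 0"
  proof -
    have "M ^ 4 = 2 * (\<alpha> * (\<rho> * M\<^sup>2 + \<Psi> M))"
      using PM by (simp add: P_def algebra_simps)
    moreover have "\<alpha> * (v M * M\<^sup>2) < \<alpha> * (\<rho> * M\<^sup>2 + 2 * \<Psi> M)"
      using transversal[OF M0 PM] pos by (intro mult_strict_left_mono)
    ultimately have "(\<alpha> * (\<rho> + v M)) * M\<^sup>2 < M\<^sup>2 * M\<^sup>2"
      by (simp add: algebra_simps power4_eq_xxxx power2_eq_square)
    then have "\<alpha> * (\<rho> + v M) < M\<^sup>2"
      by (rule mult_right_less_imp_less) simp
    then show ?thesis
      using M0 by (simp add: p_def mult_less_0_iff)
  qed
  obtain U U' where
    dU: "\<And>x. (U has_real_derivative U' x) (at x)"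
    and dU': "\<And>x. (U' has_real_derivative p (U x) / 2) (at x)"
    and UM: "\<And>x. 0 < U x \<and> U x \<le> M"
    and even: "\<And>x. U (- x) = U x"
    and decr: "\<And>x y. \<bar>x\<bar> \<le> \<bar>y\<bar> \<Longrightarrow> U y \<le> U x"
    and sq: "square_integrable U" "square_integrable U'"
  proof (rule homoclinic_orbit[where M = M and P = P and p = p and \<delta> = \<delta>
        and k = "sqrt (\<alpha> * \<rho> / 2)" and C = "sqrt (2 * (\<alpha> * \<rho>))"])
    show "(P has_real_derivative p u) (at u)" if "0 < u" "u \<le> M" for u
      using dP that M0 m by simp
    show "(sqrt (\<alpha> * \<rho> / 2) * u)\<^sup>2 \<le> P u \<and> P u \<le> (sqrt (2 * (\<alpha> * \<rho>)) * u)\<^sup>2"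
      if "0 < u" "u < \<delta>" for u
      using Psmall[OF that] \<alpha>\<rho> by (simp add: power_mult_distrib)
  qed (use \<alpha>\<rho> M0 Ppos' PM pM \<delta> in auto)
  have UL: "0 < U x" "U x < L" for x
    using UM[of x] M0 m by auto
  have cU: "isCont U x" and cU': "isCont U' x" for x
    using dU dU' DERIV_isCont by blast+
  have cv: "isCont v u" if "0 < u" "u < L" for u
    using dv[OF that] DERIV_isCont by blast
  have derivU: "deriv U = U'"
    using dU by (intro ext DERIV_imp_deriv)
  have derivU': "deriv U' x = p (U x) / 2" for x
    using dU' by (rule DERIV_imp_deriv)
  have dV: "((\<lambda>x. v (U x)) has_real_derivative v' (U x) * U' x) (at x)" for x
    by (rule DERIV_chain2[OF dv[OF UL] dU])
  have C1: "f C1_differentiable_on UNIV"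
    if "\<And>x. (f has_real_derivative f' x) (at x)" "\<And>x. isCont f' x" for f f' :: "real \<Rightarrow> real"
    unfolding C1_differentiable_on_def
    using that by (auto simp: has_real_derivative_iff_has_vector_derivative
        intro!: exI[of _ f'] continuous_at_imp_continuous_on)
  show thesis
  proof (rule that[OF _ _ UL])
    show "solves_S \<rho> a b \<alpha> U (\<lambda>x. v (U x))"
      unfolding solves_S_def derivU
    proof (intro conjI allI)
      show "U C1_differentiable_on UNIV"
        using dU cU' by (rule C1)
      show "U' C1_differentiable_on UNIV"
        by (rule C1[OF dU']) (auto simp: p_def intro!: continuous_intros cU isCont_o2[OF cU cv] UL)
      show "(\<lambda>x. v (U x)) C1_differentiable_on UNIV"
        by (rule C1[OF dV]) (auto intro!: continuous_intros cU' isCont_o2[OF cU cv'] UL)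
      show "deriv U' x + U x ^ 3 - \<alpha> * (v (U x) + \<rho>) * U x = 0" for x
        by (simp add: derivU' p_def field_simps power2_eq_square power3_eq_cube)
      have "deriv (\<lambda>y. U y ^ 2) x = 2 * U x * U' x" for x
        by (rule DERIV_imp_deriv) (auto intro!: derivative_eq_intros dU)
      moreover have "deriv (\<lambda>y. \<alpha> * U y ^ 2) x = \<alpha> * (2 * U x * U' x)" for x
        by (rule DERIV_imp_deriv) (auto intro!: derivative_eq_intros dU)
      ultimately show "deriv (\<lambda>y. a * v (U y) ^ 2 - b * v (U y) ^ 3) x = \<alpha> * deriv (\<lambda>y. U y ^ 2) x" for x
        by (simp add: branch[OF UL])
    qed
    have "weak_derivative U U'"
      by (rule weak_derivative_C1[OF dU]) (simp add: continuous_at_imp_continuous_on cU')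
    then show "U \<in> H1_rd"
      using sq even decr by (auto simp: H1_rd_def H1_def)
  qed
qed

text \<open>For negative \<open>v\<close> also \<open>\<Psi> \<le> 0\<close>, so \<open>P\<close> is
  nonpositive at \<open>sqrt (2 * \<alpha> * \<rho>)\<close>, the positive zero of \<open>P\<close>
  without its \<open>\<Psi>\<close> term. Transversality is the sum of
  \<open>\<Psi> w \<ge> v w * w\<^sup>2\<close>, from monotonicity of \<open>v\<close>, and
  \<open>\<rho> * w\<^sup>2 + \<Psi> w > 0\<close>, from \<open>P w = 0\<close>.\<close>

lemma solution_on_negative_branch:
  fixes v v' \<Psi> :: "real \<Rightarrow> real"
  assumes pos: "\<alpha> > 0" "\<rho> > 0"
    and L: "sqrt (2 * \<alpha> * \<rho>) < L"
    and neg: "\<And>u. 0 < u \<Longrightarrow> u < L \<Longrightarrow> v u \<le> 0"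
    and anti: "\<And>u w. 0 < u \<Longrightarrow> u \<le> w \<Longrightarrow> w < L \<Longrightarrow> v w \<le> v u"
    and dv: "\<And>u. 0 < u \<Longrightarrow> u < L \<Longrightarrow> (v has_real_derivative v' u) (at u)"
    and cv': "\<And>u. 0 < u \<Longrightarrow> u < L \<Longrightarrow> isCont v' u"
    and v0: "(v \<longlongrightarrow> 0) (at_right 0)"
    and d\<Psi>: "\<And>u. 0 < u \<Longrightarrow> u < L \<Longrightarrow> (\<Psi> has_real_derivative 2 * u * v u) (at u)"
    and \<Psi>0: "(\<Psi> \<longlongrightarrow> 0) (at_right 0)"
    and branch: "\<And>u. 0 < u \<Longrightarrow> u < L \<Longrightarrow> a * (v u)\<^sup>2 - b * v u ^ 3 = \<alpha> * u\<^sup>2"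
  obtains U where "solves_S \<rho> a b \<alpha> U (\<lambda>x. v (U x))" "U \<in> H1_rd"
    "\<And>x. 0 < U x" "\<And>x. U x < L"
proof (rule solution_on_branch[OF pos dv cv' v0 d\<Psi> \<Psi>0, where m = "sqrt (2 * \<alpha> * \<rho>)"])
  let ?m = "sqrt (2 * \<alpha> * \<rho>)"
  show m: "0 < ?m"
    using pos by simp
  have "- \<Psi> ?m \<ge> 0"
  proof (rule nonneg_of_deriv_nonneg_at_right_0[where f = "\<lambda>u. - \<Psi> u", OF m])
    show "((\<lambda>u. - \<Psi> u) \<longlongrightarrow> 0) (at_right 0)"
      using tendsto_minus[OF \<Psi>0] by simp
    show "((\<lambda>u. - \<Psi> u) has_real_derivative - (2 * u * v u)) (at u) \<and> 0 \<le> - (2 * u * v u)"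
      if "0 < u" "u \<le> ?m" for u
      using that L neg[of u] by (auto intro!: DERIV_minus d\<Psi> simp: mult_le_0_iff)
  qed
  then have "\<alpha> * \<Psi> ?m \<le> 0"
    using pos by (simp add: mult_le_0_iff)
  moreover have "?m ^ 4 / 2 = \<alpha> * \<rho> * ?m\<^sup>2"
    using pos by (simp add: power4_eq_xxxx power2_eq_square)
  ultimately show "\<alpha> * \<rho> * ?m\<^sup>2 + \<alpha> * \<Psi> ?m - ?m ^ 4 / 2 \<le> 0"
    by linarith
  show "v w * w\<^sup>2 < \<rho> * w\<^sup>2 + 2 * \<Psi> w"
    if w: "0 < w" "w \<le> ?m" and P0: "\<alpha> * \<rho> * w\<^sup>2 + \<alpha> * \<Psi> w - w ^ 4 / 2 = 0" for w
  proof -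
    have "\<Psi> w - v w * w\<^sup>2 \<ge> 0"
    proof (rule nonneg_of_deriv_nonneg_at_right_0[where f = "\<lambda>u. \<Psi> u - v w * u\<^sup>2", OF w(1)])
      show "((\<lambda>u. \<Psi> u - v w * u\<^sup>2) \<longlongrightarrow> 0) (at_right 0)"
      proof -
        have "((\<lambda>u. \<Psi> u - v w * u\<^sup>2) \<longlongrightarrow> 0 - v w * 0\<^sup>2) (at_right 0)"
          by (intro tendsto_intros \<Psi>0)
        then show ?thesis by simp
      qed
      show "((\<lambda>u. \<Psi> u - v w * u\<^sup>2) has_real_derivative 2 * u * (v u - v w)) (at u)
          \<and> 0 \<le> 2 * u * (v u - v w)" if "0 < u" "u \<le> w" for u
        using that w L anti[of u w] by (auto intro!: derivative_eq_intros d\<Psi> simp: algebra_simps)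
    qed
    moreover have "\<rho> * w\<^sup>2 + \<Psi> w > 0"
    proof -
      have "\<alpha> * (\<rho> * w\<^sup>2 + \<Psi> w) = w ^ 4 / 2"
        using P0 by (simp add: algebra_simps)
      also have "\<dots> > 0"
        using w by simp
      finally show ?thesis
        using pos by (simp add: zero_less_mult_iff)
    qed
    ultimately show ?thesis by linarith
  qed
qed (use L branch in auto)

text \<open>The sign \<open>\<sigma> = \<plusminus> 1\<close> is that of \<open>v\<close>; the branch is parametrised by \<open>\<sigma> v \<in> (0, q)\<close>.\<close>

lemma cubic_branch:
  fixes \<sigma> :: real
  assumes pos: "a > 0" "\<alpha> > 0" "q > 0" and \<sigma>: "\<sigma> * \<sigma> = 1"
    and slope: "\<And>t. 0 < t \<Longrightarrow> t \<le> q \<Longrightarrow> 3 * (\<sigma> * b) * t < 2 * a"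
  obtains L and v v' \<Psi> :: "real \<Rightarrow> real" where
    "L = sqrt ((a * q\<^sup>2 - \<sigma> * b * q ^ 3) / \<alpha>)"
    "\<And>u. 0 < u \<Longrightarrow> u < L \<Longrightarrow> 0 < \<sigma> * v u \<and> \<sigma> * v u < q"
    "\<And>u w. 0 < u \<Longrightarrow> u \<le> w \<Longrightarrow> w < L \<Longrightarrow> \<sigma> * v u \<le> \<sigma> * v w"
    "\<And>u. 0 < u \<Longrightarrow> u < L \<Longrightarrow> (v has_real_derivative v' u) (at u)"
    "\<And>u. 0 < u \<Longrightarrow> u < L \<Longrightarrow> isCont v' u"
    "(v \<longlongrightarrow> 0) (at_right 0)"
    "\<And>u. 0 < u \<Longrightarrow> u < L \<Longrightarrow> (\<Psi> has_real_derivative 2 * u * v u) (at u)"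
    "(\<Psi> \<longlongrightarrow> 0) (at_right 0)"
    "\<And>u. 0 < u \<Longrightarrow> u < L \<Longrightarrow> a * (v u)\<^sup>2 - b * v u ^ 3 = \<alpha> * u\<^sup>2"
proof -
  \<comment> \<open>With \<open>t = \<sigma> * v\<close> the constraint reads
    \<open>u = w t\<close>. The slope hypothesis keeps the derivative of \<open>h\<close> positive,
    so \<open>w\<close> is invertible up to \<open>q\<close>.\<close>
  define h where "h t = (a * t\<^sup>2 - \<sigma> * b * t ^ 3) / \<alpha>" for t
  define w where "w t = sqrt (h t)" for t
  define w' where "w' t = (2 * a * t - 3 * (\<sigma> * b) * t\<^sup>2) / (2 * \<alpha> * w t)" for t
  have hpos: "h t > 0" if "0 < t" "t \<le> q" for t
  proof -
    have "\<sigma> * b * t < a"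
      using slope[OF that] pos by linarith
    then have "t\<^sup>2 * (a - \<sigma> * b * t) > 0"
      using that by simp
    then show ?thesis
      using pos by (simp add: h_def algebra_simps power2_eq_square power3_eq_cube)
  qed
  have wpos: "w t > 0" and wsq: "(w t)\<^sup>2 = h t" if "0 < t" "t \<le> q" for t
    using hpos[OF that] by (auto simp: w_def)
  have num: "2 * a * t - 3 * (\<sigma> * b) * t\<^sup>2 > 0" if "0 < t" "t \<le> q" for t
  proof -
    have "t * (2 * a - 3 * (\<sigma> * b) * t) > 0"
      using slope[OF that] that by simp
    then show ?thesis
      by (simp add: algebra_simps power2_eq_square)
  qed
  have dw: "(w has_real_derivative w' t) (at t)" if "0 < t" "t \<le> q" for t
  proof -
    have "(h has_real_derivative (2 * a * t - 3 * (\<sigma> * b) * t\<^sup>2) / \<alpha>) (at t)"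
      unfolding h_def using pos
      by (auto intro!: derivative_eq_intros simp: field_simps power2_eq_square)
    then have "(w has_real_derivative inverse (sqrt (h t)) / 2 * ((2 * a * t - 3 * (\<sigma> * b) * t\<^sup>2) / \<alpha>)) (at t)"
      unfolding w_def using hpos[OF that] by (intro DERIV_chain2[of sqrt] DERIV_real_sqrt)
    moreover have "inverse (sqrt (h t)) / 2 * ((2 * a * t - 3 * (\<sigma> * b) * t\<^sup>2) / \<alpha>) = w' t"
      using pos wpos[OF that] by (simp add: w'_def w_def[symmetric] field_simps)
    ultimately show ?thesis by simp
  qed
  have w'pos: "w' t > 0" if "0 < t" "t \<le> q" for t
    using num[OF that] wpos[OF that] pos by (simp add: w'_def)
  have cw: "continuous_on {0..q} w"
    unfolding w_def h_def using pos by (intro continuous_intros) auto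
  have w0: "w 0 = 0"
    by (simp add: w_def h_def)
  have wmono: "w s < w t" if "0 \<le> s" "s < t" "t \<le> q" for s t
  proof (rule DERIV_pos_imp_increasing_open[OF that(2)])
    show "\<exists>y. (w has_real_derivative y) (at z) \<and> 0 < y" if "s < z" "z < t" for z
      using that \<open>0 \<le> s\<close> \<open>t \<le> q\<close> by (intro exI[of _ "w' z"] conjI dw w'pos) auto
    show "continuous_on {s..t} w"
      by (rule continuous_on_subset[OF cw]) (use that in auto)
  qed
  have image: "w ` {0<..<q} = {0<..<w q}"
  proof (intro equalityI subsetI)
    fix u assume "u \<in> {0<..<w q}"
    then have u: "0 < u" "u < w q" by auto
    then obtain t where "0 \<le> t" "t \<le> q" "w t = u"
      using IVT'[of w 0 u q] cw w0 pos by auto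
    then show "u \<in> w ` {0<..<q}"
      using u w0 by (cases "t = 0"; cases "t = q") auto
  qed (use wpos wmono in auto)
  obtain g where g_raw: "\<And>t. t \<in> {0<..<q} \<Longrightarrow> g (w t) = t"
    "\<And>u. u \<in> w ` {0<..<q} \<Longrightarrow> g u \<in> {0<..<q}" "\<And>u. u \<in> w ` {0<..<q} \<Longrightarrow> w (g u) = u"
    "\<And>u. u \<in> w ` {0<..<q} \<Longrightarrow> (g has_real_derivative inverse (w' (g u))) (at u)"
    "\<And>u z. u \<in> w ` {0<..<q} \<Longrightarrow> z \<in> w ` {0<..<q} \<Longrightarrow> u < z \<Longrightarrow> g u < g z"
    by (rule increasing_inverse[of "{0<..<q}" w w']) (use dw w'pos in \<open>auto simp: is_interval_1\<close>)
  note gi = g_raw(2-)[unfolded image]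
  have g: "0 < g u" "g u < q" and wg: "w (g u) = u" if "0 < u" "u < w q" for u
    using gi(1,2)[of u] that by auto
  \<comment> \<open>This is the reciprocal of \<open>w'\<close> at \<open>g u\<close> with
    \<open>w (g u)\<close> replaced by \<open>u\<close>; the square root is gone and continuity
    follows from that of \<open>g\<close>.\<close>
  define g' where "g' u = 2 * \<alpha> * u / (2 * a * g u - 3 * (\<sigma> * b) * (g u)\<^sup>2)" for u
  have dg: "(g has_real_derivative g' u) (at u)" if "0 < u" "u < w q" for u
    using gi(3)[of u] that wg[OF that] by (simp add: w'_def g'_def)
  have gmono: "g u < g z" if "0 < u" "u < z" "z < w q" for u z
    using gi(4)[of u z] that by auto
  have cg: "isCont g u" if "0 < u" "u < w q" for u
    using dg[OF that] DERIV_isCont by blast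
  have numg: "2 * a * g u - 3 * (\<sigma> * b) * (g u)\<^sup>2 > 0" if "0 < u" "u < w q" for u
    using num[of "g u"] g[OF that] by simp
  have cg': "isCont g' u" if "0 < u" "u < w q" for u
    unfolding g'_def using numg[OF that] by (intro continuous_intros cg that) auto
  have g0: "(g \<longlongrightarrow> 0) (at_right 0)"
  proof (rule tendstoI)
    fix e :: real assume "e > 0"
    define t where "t = min e q / 2"
    have t: "0 < t" "t < e" "t < q"
      using \<open>e > 0\<close> pos by (auto simp: t_def)
    have "dist (g u) 0 < e" if u: "0 < u" "u < w t" for u
    proof -
      have "w t < w q"
        using wmono[of t q] t by simp
      then have "0 < g u" "g u < g (w t)"
        using g[of u] gmono[of u "w t"] u by auto
      then show ?thesis
        using g_raw(1)[of t] t by simp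
    qed
    then show "\<forall>\<^sub>F u in at_right 0. dist (g u) 0 < e"
      using wpos[of t] t by (auto simp: eventually_at_right_field)
  qed
  have eq: "a * (g u)\<^sup>2 - \<sigma> * b * (g u) ^ 3 = \<alpha> * u\<^sup>2" if "0 < u" "u < w q" for u
    using wsq[of "g u"] g[OF that] wg[OF that] pos by (simp add: h_def field_simps)
  have \<sigma>3: "\<sigma> * (\<sigma> * x) = x" for x
    using \<sigma> by (simp flip: mult.assoc)
  define v where "v u = \<sigma> * g u" for u
  \<comment> \<open>Differentiating the constraint gives
    \<open>2 * \<alpha> * u du = (2 * a * v - 3 * b * v\<^sup>2) dv\<close>. Multiplying by
    \<open>v\<close> and integrating in \<open>v\<close> yields this closed form.\<close>
  define \<Psi> where "\<Psi> u = (2 * a / 3 * v u ^ 3 - 3 * b / 4 * v u ^ 4) / \<alpha>" for u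
  have dv: "(v has_real_derivative \<sigma> * g' u) (at u)" if "0 < u" "u < w q" for u
    unfolding v_def by (intro DERIV_cmult dg that)
  have v0: "(v \<longlongrightarrow> 0) (at_right 0)"
    unfolding v_def by (auto intro!: tendsto_eq_intros g0)
  show thesis
  proof
    show "w q = sqrt ((a * q\<^sup>2 - \<sigma> * b * q ^ 3) / \<alpha>)"
      by (simp add: w_def h_def)
    show "0 < \<sigma> * v u \<and> \<sigma> * v u < q" if "0 < u" "u < w q" for u
      using g[OF that] by (simp add: v_def \<sigma>3)
    show "\<sigma> * v u \<le> \<sigma> * v z" if "0 < u" "u \<le> z" "z < w q" for u z
      using gmono[of u z] that by (cases "u = z") (auto simp: v_def \<sigma>3)
    show "isCont (\<lambda>u. \<sigma> * g' u) u" if "0 < u" "u < w q" for u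
      by (intro continuous_intros cg' that)
    show "(\<Psi> \<longlongrightarrow> 0) (at_right 0)"
      unfolding \<Psi>_def using pos by (auto intro!: tendsto_eq_intros v0)
    show "a * (v u)\<^sup>2 - b * v u ^ 3 = \<alpha> * u\<^sup>2" if "0 < u" "u < w q" for u
      using eq[OF that] \<sigma>3[of 1] by (simp add: v_def power2_eq_square power3_eq_cube mult_ac \<sigma>3)
    show "(\<Psi> has_real_derivative 2 * u * v u) (at u)" if "0 < u" "u < w q" for u
    proof -
      have "(\<Psi> has_real_derivative (2 * a * (v u)\<^sup>2 - 3 * b * v u ^ 3) * (\<sigma> * g' u) / \<alpha>) (at u)"
        unfolding \<Psi>_def using pos
        by (auto intro!: derivative_eq_intros dv that
            simp: field_simps power2_eq_square power3_eq_cube)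
      moreover have "(2 * a * (v u)\<^sup>2 - 3 * b * v u ^ 3) * (\<sigma> * g' u) / \<alpha> = 2 * u * v u"
      proof -
        have "2 * a * (v u)\<^sup>2 - 3 * b * v u ^ 3
            = g u * (2 * a * g u - 3 * (\<sigma> * b) * (g u)\<^sup>2)"
          by (simp add: v_def power2_eq_square power3_eq_cube algebra_simps \<sigma>3)
        then show ?thesis
          using numg[OF that] pos by (simp add: g'_def v_def)
      qed
      ultimately show ?thesis by simp
    qed
  qed (use dv v0 in auto)
qed

section \<open>The individual branches\<close>

lemma solution_cubic_root_branch:
  fixes \<alpha> b \<rho> :: real
  assumes pos: "\<alpha> > 0" "b > 0" "\<rho> > 0"
  shows "\<exists>U. solves_S \<rho> 0 b \<alpha> U (\<lambda>x. - ((\<alpha> / b) powr (1/3)) * U x powr (2/3)) \<and>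
    U \<in> H1_rd \<and> (\<forall>x. U x > 0)"
proof -
  define c where "c = (\<alpha> / b) powr (1/3)"
  have c: "c > 0"
    using pos by (simp add: c_def)
  have "c ^ 3 = c powr 3"
    using c by (simp add: powr_numeral)
  also have "\<dots> = \<alpha> / b"
    using pos by (simp add: c_def powr_powr)
  finally have c3: "c ^ 3 = \<alpha> / b" .
  \<comment> \<open>The branch is explicit for all positive \<open>u\<close>, so any
    \<open>L\<close> beyond \<open>sqrt (2 * \<alpha> * \<rho>)\<close> will do.
    \<open>\<Psi>\<close> is the primitive of \<open>2 * u * v u\<close> that tends to 0 at
    0.\<close>
  obtain U where "solves_S \<rho> 0 b \<alpha> U (\<lambda>x. - c * U x powr (2/3))" "U \<in> H1_rd" "\<And>x. 0 < U x"
  proof (rule solution_on_negative_branch[where \<alpha> = \<alpha> and \<rho> = \<rho> and a = 0 and b = b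
        and L = "sqrt (2 * \<alpha> * \<rho>) + 1" and v = "\<lambda>u. - c * u powr (2/3)"
        and v' = "\<lambda>u. - c * (2/3) * u powr (-1/3)" and \<Psi> = "\<lambda>u. - (3/4) * c * u powr (8/3)"])
    fix u :: real assume u: "0 < u"
    show "- c * u powr (2/3) \<le> 0"
      using c by simp
    show "- c * z powr (2/3) \<le> - c * u powr (2/3)" if "u \<le> z" for z
      using c u that by (simp add: powr_mono2)
    show "((\<lambda>u. - c * u powr (2/3)) has_real_derivative - c * (2/3) * u powr (-1/3)) (at u)"
      using u by (auto intro!: derivative_eq_intros)
    show "isCont (\<lambda>u. - c * (2/3) * u powr (-1/3)) u"
      using u by (intro continuous_intros) auto
    have "u * u powr (2/3) = u powr (5/3)"
      using u powr_add[of u 1 "2/3"] by simp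
    then have "2 * u * (- c * u powr (2/3)) = - 2 * c * u powr (5/3)"
      by (simp flip: mult.assoc add: mult.commute[of _ u])
    moreover have "((\<lambda>u. - (3/4) * c * u powr (8/3)) has_real_derivative - 2 * c * u powr (5/3)) (at u)"
      using u by (auto intro!: derivative_eq_intros)
    ultimately show "((\<lambda>u. - (3/4) * c * u powr (8/3)) has_real_derivative 2 * u * (- c * u powr (2/3))) (at u)"
      by (simp only:)
    have "(u powr (2/3)) ^ 3 = u\<^sup>2"
      using u by (simp add: powr_powr flip: powr_numeral)
    then show "0 * (- c * u powr (2/3))\<^sup>2 - b * (- c * u powr (2/3)) ^ 3 = \<alpha> * u\<^sup>2"
      using pos c3 by (simp add: power_mult_distrib)
  next
    have lim: "((\<lambda>u::real. d * u powr s) \<longlongrightarrow> 0) (at_right 0)" if "s > 0" for d s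
    proof -
      have "((\<lambda>u::real. d * u powr s) \<longlongrightarrow> d * 0 powr s) (at_right 0)"
        using that by (intro tendsto_intros tendsto_powr')
          (auto simp: eventually_at_right_field intro!: exI[of _ 1])
      then show ?thesis by simp
    qed
    show "((\<lambda>u::real. - c * u powr (2/3)) \<longlongrightarrow> 0) (at_right 0)"
      "((\<lambda>u::real. - (3/4) * c * u powr (8/3)) \<longlongrightarrow> 0) (at_right 0)"
      by (rule lim; simp)+
  qed (use pos in auto)
  then show ?thesis
    unfolding c_def by blast
qed

lemma solutions_linear_branches:
  fixes \<alpha> a \<rho> :: real
  assumes pos: "\<alpha> > 0" "a > 0" "\<rho> > 0"
  shows "\<exists>U. solves_S \<rho> a 0 \<alpha> U (\<lambda>x. - ((\<alpha> / a) powr (1/2)) * U x) \<and> U \<in> H1_rd \<and> (\<forall>x. U x > 0)"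
    and "\<exists>U. solves_S \<rho> a 0 \<alpha> U (\<lambda>x. (\<alpha> / a) powr (1/2) * U x) \<and> U \<in> H1_rd \<and> (\<forall>x. U x > 0)"
proof -
  define c where "c = (\<alpha> / a) powr (1/2)"
  have c: "c > 0"
    using pos by (simp add: c_def)
  have c2: "c\<^sup>2 = \<alpha> / a"
    using pos by (simp add: c_def powr_half_sqrt)
  have branch: "a * (d * u)\<^sup>2 - 0 * (d * u) ^ 3 = \<alpha> * u\<^sup>2" if "d\<^sup>2 = c\<^sup>2" for d u
    using pos c2 that by (simp add: power_mult_distrib)
  have dv: "((\<lambda>u. d * u) has_real_derivative d) (at u)" for d u :: real
    by (auto intro!: derivative_eq_intros)
  have d\<Psi>: "((\<lambda>u. 2/3 * d * u ^ 3) has_real_derivative 2 * u * (d * u)) (at u)" for d u :: real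
    by (auto intro!: derivative_eq_intros simp: power2_eq_square)
  have v0: "((\<lambda>u. d * u) \<longlongrightarrow> 0) (at_right 0)" for d :: real
    by (auto intro!: tendsto_eq_intros)
  have \<Psi>0: "((\<lambda>u. 2/3 * d * u ^ 3) \<longlongrightarrow> 0) (at_right 0)" for d :: real
    by (auto intro!: tendsto_eq_intros)
  obtain U where "solves_S \<rho> a 0 \<alpha> U (\<lambda>x. - c * U x)" "U \<in> H1_rd" "\<And>x. 0 < U x"
  proof (rule solution_on_negative_branch[where \<alpha> = \<alpha> and \<rho> = \<rho> and a = a and b = 0
        and L = "sqrt (2 * \<alpha> * \<rho>) + 1" and v = "\<lambda>u. - c * u"
        and v' = "\<lambda>u. - c" and \<Psi> = "\<lambda>u. 2/3 * - c * u ^ 3"])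
  qed (use pos c dv[of "- c"] d\<Psi>[of "- c"] v0[of "- c"] \<Psi>0[of "- c"] branch[of "- c"] in auto)
  then show "\<exists>U. solves_S \<rho> a 0 \<alpha> U (\<lambda>x. - ((\<alpha> / a) powr (1/2)) * U x) \<and> U \<in> H1_rd \<and> (\<forall>x. U x > 0)"
    unfolding c_def by blast
  \<comment> \<open>For this branch \<open>P u / u\<^sup>2\<close> is the quadratic
    \<open>\<alpha> * \<rho> + 2/3 * \<alpha> * c * u - u\<^sup>2 / 2\<close>. The value
    \<open>m\<close> is a convenient point past its positive root, where completing the computation
    leaves only negative terms.\<close>
  define s where "s = sqrt (2 * \<alpha> * \<rho>)"
  define m where "m = 2 * \<alpha> * c + s"
  have s: "s > 0" "s\<^sup>2 = 2 * \<alpha> * \<rho>"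
    using pos by (auto simp: s_def)
  have m: "m > 0"
    using pos c s by (simp add: m_def add_pos_pos)
  obtain U where "solves_S \<rho> a 0 \<alpha> U (\<lambda>x. c * U x)" "U \<in> H1_rd" "\<And>x. 0 < U x"
  proof (rule solution_on_branch[where \<alpha> = \<alpha> and \<rho> = \<rho> and a = a and b = 0
        and L = "m + 1" and m = m and v = "\<lambda>u. c * u"
        and v' = "\<lambda>u. c" and \<Psi> = "\<lambda>u. 2/3 * c * u ^ 3"])
    have "\<alpha> * \<rho> + 2/3 * \<alpha> * c * m - m\<^sup>2 / 2 = - (2/3 * (\<alpha> * c)\<^sup>2 + 4/3 * (\<alpha> * c) * s)"
      using s(2) by (simp add: m_def power2_eq_square field_simps)
    also have "\<dots> \<le> 0"
    proof -
      have "0 \<le> 2/3 * (\<alpha> * c)\<^sup>2 + 4/3 * (\<alpha> * c) * s"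
        using pos c s by (intro add_nonneg_nonneg mult_nonneg_nonneg) auto
      then show ?thesis by linarith
    qed
    finally have "m\<^sup>2 * (\<alpha> * \<rho> + 2/3 * \<alpha> * c * m - m\<^sup>2 / 2) \<le> 0"
      by (simp add: mult_nonneg_nonpos)
    then show "\<alpha> * \<rho> * m\<^sup>2 + \<alpha> * (2/3 * c * m ^ 3) - m ^ 4 / 2 \<le> 0"
      by (simp add: algebra_simps power2_eq_square power3_eq_cube power4_eq_xxxx)
    show "c * u * u\<^sup>2 < \<rho> * u\<^sup>2 + 2 * (2/3 * c * u ^ 3)" if "0 < u" for u
    proof -
      have "c * u ^ 3 > 0" "\<rho> * u\<^sup>2 > 0"
        using that c pos by auto
      then show ?thesis
        by (simp add: power2_eq_square power3_eq_cube)
    qed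
  qed (use pos c m dv d\<Psi> v0 \<Psi>0 branch in auto)
  then show "\<exists>U. solves_S \<rho> a 0 \<alpha> U (\<lambda>x. (\<alpha> / a) powr (1/2) * U x) \<and> U \<in> H1_rd \<and> (\<forall>x. U x > 0)"
    unfolding c_def by blast
qed

text \<open>For negative \<open>V\<close> the cubic term reinforces the quadratic one, so the branch
  never folds and can be followed as far as needed. Hence no smallness of \<alpha> is
  required.\<close>

lemma solution_cubic_negative:
  fixes a b \<alpha> \<rho> :: real
  assumes pos: "a > 0" "b > 0" "\<alpha> > 0" "\<rho> > 0"
  shows "\<exists>U V. solves_S \<rho> a b \<alpha> U V \<and> (\<forall>x. U x > 0) \<and> (\<forall>x. V x < 0) \<and> U \<in> H1 \<and>
    (\<forall>x. a * V x ^ 2 - b * V x ^ 3 = \<alpha> * U x ^ 2)"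
proof -
  \<comment> \<open>Chosen so that \<open>a * q\<^sup>2 > 2 * \<alpha>\<^sup>2 * \<rho>\<close>,
    which gives \<open>L > sqrt (2 * \<alpha> * \<rho>)\<close>; the added 1 makes the inequality
    strict.\<close>
  define q where "q = sqrt (2 * \<alpha>\<^sup>2 * \<rho> / a) + 1"
  have q: "q > 0"
    using pos by (auto simp: q_def intro: add_nonneg_pos)
  have slope: "3 * (- 1 * b) * t < 2 * a" if "0 < t" "t \<le> q" for t
    using pos that by (smt (verit) mult_pos_pos mult_minus_left)
  obtain L and v v' \<Psi> :: "real \<Rightarrow> real" where
    L: "L = sqrt ((a * q\<^sup>2 - - 1 * b * q ^ 3) / \<alpha>)"
    and v: "\<And>u. 0 < u \<Longrightarrow> u < L \<Longrightarrow> 0 < - 1 * v u \<and> - 1 * v u < q"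
    and mono: "\<And>u w. 0 < u \<Longrightarrow> u \<le> w \<Longrightarrow> w < L \<Longrightarrow> - 1 * v u \<le> - 1 * v w"
    and rest: "\<And>u. 0 < u \<Longrightarrow> u < L \<Longrightarrow> (v has_real_derivative v' u) (at u)"
    "\<And>u. 0 < u \<Longrightarrow> u < L \<Longrightarrow> isCont v' u" "(v \<longlongrightarrow> 0) (at_right 0)"
    "\<And>u. 0 < u \<Longrightarrow> u < L \<Longrightarrow> (\<Psi> has_real_derivative 2 * u * v u) (at u)" "(\<Psi> \<longlongrightarrow> 0) (at_right 0)"
    and branch: "\<And>u. 0 < u \<Longrightarrow> u < L \<Longrightarrow> a * (v u)\<^sup>2 - b * v u ^ 3 = \<alpha> * u\<^sup>2"
    by (rule cubic_branch[OF pos(1,3) q _ slope]) (simp, assumption, assumption, (rule that; assumption))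
  have "(sqrt (2 * \<alpha>\<^sup>2 * \<rho> / a))\<^sup>2 < q\<^sup>2"
    using pos by (intro power_strict_mono) (auto simp: q_def)
  then have "2 * \<alpha>\<^sup>2 * \<rho> / a < q\<^sup>2"
    using pos by simp
  then have "2 * \<alpha> * \<rho> * \<alpha> < a * q\<^sup>2"
    using pos by (simp add: field_simps power2_eq_square)
  also have "\<dots> \<le> a * q\<^sup>2 - - 1 * b * q ^ 3"
    using pos q by simp
  finally have "sqrt (2 * \<alpha> * \<rho>) < L"
    using pos by (simp add: L pos_less_divide_eq)
  then obtain U where U: "solves_S \<rho> a b \<alpha> U (\<lambda>x. v (U x))" "U \<in> H1_rd" "\<And>x. 0 < U x" "\<And>x. U x < L"
  proof (rule solution_on_negative_branch[OF pos(3,4), of L v v' \<Psi>])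
    show "v u \<le> 0" if "0 < u" "u < L" for u
      using v[OF that] by simp
    show "v z \<le> v u" if "0 < u" "u \<le> z" "z < L" for u z
      using mono[OF that] by simp
  qed (use rest branch in auto)
  have "v (U x) < 0" for x
    using v[OF U(3,4), of x] by simp
  then show ?thesis
    using U branch[OF U(3,4)]
    by (intro exI[of _ U] exI[of _ "\<lambda>x. v (U x)"]) (auto simp: H1_rd_def)
qed

text \<open>The positive branch folds at \<open>v = 2 * a / (3 * b)\<close>. The bound
  \<open>a / (2 * b)\<close> in \<open>q\<close> stays below the fold, and the bound \<rho> yields
  transversality because \<open>v < \<rho>\<close> and \<open>\<Psi> \<ge> 0\<close>. Small \<alpha>
  lets the branch reach beyond the first zero of \<open>P\<close>.\<close>

lemma solution_cubic_positive:
  fixes a b \<alpha> \<rho> :: real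
  assumes pos: "a > 0" "b > 0" "\<alpha> > 0" "\<rho> > 0"
    and q_def: "q = min \<rho> (a / (2 * b))" and small: "\<alpha> < q * sqrt (a / (8 * \<rho>))"
  shows "\<exists>U V. solves_S \<rho> a b \<alpha> U V \<and> (\<forall>x. U x > 0) \<and> (\<forall>x. V x > 0) \<and> U \<in> H1 \<and>
    (\<forall>x. a * V x ^ 2 - b * V x ^ 3 = \<alpha> * U x ^ 2)"
proof -
  have q: "q > 0" "q \<le> \<rho>" "2 * (b * q) \<le> a"
    using pos by (auto simp: q_def min_def field_simps)
  have slope: "3 * (1 * b) * t < 2 * a" if "0 < t" "t \<le> q" for t
    using q(3) mult_left_mono[OF that(2), of b] pos by linarith
  obtain L and v v' \<Psi> :: "real \<Rightarrow> real" where
    L: "L = sqrt ((a * q\<^sup>2 - 1 * b * q ^ 3) / \<alpha>)"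
    and v: "\<And>u. 0 < u \<Longrightarrow> u < L \<Longrightarrow> 0 < 1 * v u \<and> 1 * v u < q"
    and "\<And>u w. 0 < u \<Longrightarrow> u \<le> w \<Longrightarrow> w < L \<Longrightarrow> 1 * v u \<le> 1 * v w"
    and dv: "\<And>u. 0 < u \<Longrightarrow> u < L \<Longrightarrow> (v has_real_derivative v' u) (at u)"
    and cv': "\<And>u. 0 < u \<Longrightarrow> u < L \<Longrightarrow> isCont v' u" and v0: "(v \<longlongrightarrow> 0) (at_right 0)"
    and d\<Psi>: "\<And>u. 0 < u \<Longrightarrow> u < L \<Longrightarrow> (\<Psi> has_real_derivative 2 * u * v u) (at u)"
    and \<Psi>0: "(\<Psi> \<longlongrightarrow> 0) (at_right 0)"
    and branch: "\<And>u. 0 < u \<Longrightarrow> u < L \<Longrightarrow> a * (v u)\<^sup>2 - b * v u ^ 3 = \<alpha> * u\<^sup>2"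
    by (rule cubic_branch[OF pos(1,3) q(1) _ slope]) (simp, assumption, assumption, (rule that; assumption))
  \<comment> \<open>Since \<open>v < \<rho>\<close> gives
    \<open>\<Psi> m \<le> \<rho> * m\<^sup>2\<close>, \<open>P m\<close> is at most
    \<open>2 * \<alpha> * \<rho> * m\<^sup>2 - m ^ 4 / 2\<close>, which vanishes for this
    \<open>m\<close>.\<close>
  define m where "m = sqrt (4 * \<alpha> * \<rho>)"
  have m: "m > 0" "m\<^sup>2 = 4 * \<alpha> * \<rho>"
    using pos by (auto simp: m_def)
  \<comment> \<open>The threshold on \<alpha> is exactly
    \<open>4 * \<alpha>\<^sup>2 * \<rho> < q\<^sup>2 * a / 2\<close>, and
    \<open>b * q \<le> a / 2\<close> turns this into \<open>m < L\<close>.\<close>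
  have "\<alpha>\<^sup>2 < (q * sqrt (a / (8 * \<rho>)))\<^sup>2"
    using small pos by (intro power_strict_mono) auto
  also have "\<dots> = q\<^sup>2 * a / (8 * \<rho>)"
    using pos by (simp add: power_mult_distrib)
  finally have "4 * \<alpha> * \<rho> * \<alpha> < q\<^sup>2 * (a / 2)"
    using pos by (simp add: field_simps power2_eq_square)
  also have "\<dots> \<le> q\<^sup>2 * (a - b * q)"
    using q by (intro mult_left_mono) auto
  also have "\<dots> = a * q\<^sup>2 - 1 * b * q ^ 3"
    by (simp add: algebra_simps power2_eq_square power3_eq_cube)
  finally have mL: "m < L"
    using pos by (simp add: L m_def pos_less_divide_eq)
  have vpos: "0 < v u" "v u < \<rho>" if "0 < u" "u < L" for u
    using v[OF that] q by auto
  have \<Psi>nonneg: "\<Psi> w \<ge> 0" if w: "0 < w" "w \<le> m" for w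
  proof (rule nonneg_of_deriv_nonneg_at_right_0[where f = \<Psi>, OF w(1) \<Psi>0])
    show "(\<Psi> has_real_derivative 2 * u * v u) (at u) \<and> 0 \<le> 2 * u * v u"
      if "0 < u" "u \<le> w" for u
      using that w mL vpos[of u] by (auto intro!: d\<Psi>)
  qed
  have "\<rho> * m\<^sup>2 - \<Psi> m \<ge> 0"
  proof (rule nonneg_of_deriv_nonneg_at_right_0[where f = "\<lambda>u. \<rho> * u\<^sup>2 - \<Psi> u", OF m(1)])
    have "((\<lambda>u. \<rho> * u\<^sup>2 - \<Psi> u) \<longlongrightarrow> \<rho> * 0\<^sup>2 - 0) (at_right 0)"
      by (intro tendsto_intros \<Psi>0)
    then show "((\<lambda>u. \<rho> * u\<^sup>2 - \<Psi> u) \<longlongrightarrow> 0) (at_right 0)" by simp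
    show "((\<lambda>u. \<rho> * u\<^sup>2 - \<Psi> u) has_real_derivative 2 * u * (\<rho> - v u)) (at u)
        \<and> 0 \<le> 2 * u * (\<rho> - v u)" if "0 < u" "u \<le> m" for u
      using that mL vpos[of u] by (auto intro!: derivative_eq_intros d\<Psi> simp: algebra_simps)
  qed
  then have "\<alpha> * \<Psi> m \<le> \<alpha> * (\<rho> * m\<^sup>2)"
    using pos by simp
  moreover have "m ^ 4 / 2 = 2 * (\<alpha> * (\<rho> * m\<^sup>2))"
    using m(2) by (simp add: power4_eq_xxxx power2_eq_square)
  ultimately have Pm: "\<alpha> * \<rho> * m\<^sup>2 + \<alpha> * \<Psi> m - m ^ 4 / 2 \<le> 0"
    by simp
  have transversal: "v w * w\<^sup>2 < \<rho> * w\<^sup>2 + 2 * \<Psi> w" if w: "0 < w" "w \<le> m" for w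
  proof -
    have "v w * w\<^sup>2 < \<rho> * w\<^sup>2"
      using vpos[of w] w mL by simp
    with \<Psi>nonneg[OF w] show ?thesis by linarith
  qed
  obtain U where U: "solves_S \<rho> a b \<alpha> U (\<lambda>x. v (U x))" "U \<in> H1_rd" "\<And>x. 0 < U x" "\<And>x. U x < L"
    by (rule solution_on_branch[where v = v and v' = v' and \<Psi> = \<Psi> and \<alpha> = \<alpha> and \<rho> = \<rho>
          and L = L and m = m and a = a and b = b])
      (use pos dv cv' v0 d\<Psi> \<Psi>0 m mL Pm transversal branch in auto)
  have "0 < v (U x)" for x
    using vpos[OF U(3,4), of x] by simp
  then show ?thesis
    using U branch[OF U(3,4)]
    by (intro exI[of _ U] exI[of _ "\<lambda>x. v (U x)"]) (auto simp: H1_rd_def)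
qed

section \<open>Assembly of the three parameter regimes\<close>

theorem theorem1p5:
  fixes \<rho> :: real
  assumes "\<rho> > 0"
  shows
    "(\<forall>\<alpha> a b :: real. \<alpha> > 0 \<and> a = 0 \<and> b > 0 \<longrightarrow>
        (\<exists>U V. solves_S \<rho> a b \<alpha> U V \<and>
           U \<in> H1_rd \<and> (\<forall>x. U x > 0) \<and>
           (\<forall>x. V x = - ((\<alpha> / b) powr (1/3)) * U x powr (2/3))))
     \<and>
     (\<forall>\<alpha> a b :: real. \<alpha> > 0 \<and> a > 0 \<and> b = 0 \<longrightarrow>
        (\<exists>U\<^sub>1 V\<^sub>1 U\<^sub>2 V\<^sub>2.
           (U\<^sub>1, V\<^sub>1) \<noteq> (U\<^sub>2, V\<^sub>2) \<and>
           solves_S \<rho> a b \<alpha> U\<^sub>1 V\<^sub>1 \<and> solves_S \<rho> a b \<alpha> U\<^sub>2 V\<^sub>2 \<and>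
           U\<^sub>1 \<in> H1_rd \<and> (\<forall>x. U\<^sub>1 x > 0) \<and>
           (\<forall>x. V\<^sub>1 x = - ((\<alpha> / a) powr (1/2)) * U\<^sub>1 x) \<and>
           U\<^sub>2 \<in> H1_rd \<and> (\<forall>x. U\<^sub>2 x > 0) \<and>
           (\<forall>x. V\<^sub>2 x = (\<alpha> / a) powr (1/2) * U\<^sub>2 x)))
     \<and>
     (\<forall>a b :: real. a > 0 \<and> b > 0 \<longrightarrow>
        (\<exists>\<alpha>\<^sub>0 > 0. \<forall>\<alpha>. 0 < \<alpha> \<and> \<alpha> < \<alpha>\<^sub>0 \<longrightarrow>
          (\<exists>U\<^sub>1 V\<^sub>1 U\<^sub>2 V\<^sub>2.
             (U\<^sub>1, V\<^sub>1) \<noteq> (U\<^sub>2, V\<^sub>2) \<and>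
             solves_S \<rho> a b \<alpha> U\<^sub>1 V\<^sub>1 \<and> solves_S \<rho> a b \<alpha> U\<^sub>2 V\<^sub>2 \<and>
             (\<forall>x. U\<^sub>1 x > 0) \<and> (\<forall>x. V\<^sub>1 x > 0) \<and>
             (\<forall>x. U\<^sub>2 x > 0) \<and> (\<forall>x. V\<^sub>2 x < 0) \<and>
             U\<^sub>1 \<in> H1 \<and> U\<^sub>2 \<in> H1 \<and>
             (\<forall>x. a * V\<^sub>1 x ^ 2 - b * V\<^sub>1 x ^ 3 = \<alpha> * U\<^sub>1 x ^ 2) \<and>
             (\<forall>x. a * V\<^sub>2 x ^ 2 - b * V\<^sub>2 x ^ 3 = \<alpha> * U\<^sub>2 x ^ 2))))"
proof (intro conjI allI impI; elim conjE)
  fix \<alpha> a b :: real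
  assume "\<alpha> > 0" "a = 0" "b > 0"
  then show "\<exists>U V. solves_S \<rho> a b \<alpha> U V \<and> U \<in> H1_rd \<and> (\<forall>x. U x > 0) \<and>
      (\<forall>x. V x = - ((\<alpha> / b) powr (1/3)) * U x powr (2/3))"
    using solution_cubic_root_branch[of \<alpha> b \<rho>] assms by metis
next
  fix \<alpha> a b :: real
  assume "\<alpha> > 0" "a > 0" "b = 0"
  then obtain U\<^sub>1 U\<^sub>2 where
    1: "solves_S \<rho> a b \<alpha> U\<^sub>1 (\<lambda>x. - ((\<alpha> / a) powr (1/2)) * U\<^sub>1 x)" "U\<^sub>1 \<in> H1_rd" "\<And>x. U\<^sub>1 x > 0" and
    2: "solves_S \<rho> a b \<alpha> U\<^sub>2 (\<lambda>x. (\<alpha> / a) powr (1/2) * U\<^sub>2 x)" "U\<^sub>2 \<in> H1_rd" "\<And>x. U\<^sub>2 x > 0"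
    using solutions_linear_branches[of \<alpha> a \<rho>] assms by auto
  \<comment> \<open>The two pairs differ because their second components have opposite signs at
    0.\<close>
  have "- ((\<alpha> / a) powr (1/2)) * U\<^sub>1 0 < (\<alpha> / a) powr (1/2) * U\<^sub>2 0"
    using \<open>\<alpha> > 0\<close> \<open>a > 0\<close> 1(3)[of 0] 2(3)[of 0]
    by (smt (verit) divide_pos_pos mult_minus_left mult_pos_pos powr_gt_zero)
  then have "(\<lambda>x. - ((\<alpha> / a) powr (1/2)) * U\<^sub>1 x) \<noteq> (\<lambda>x. (\<alpha> / a) powr (1/2) * U\<^sub>2 x)"
    by (metis less_irrefl)
  with 1 2 show "\<exists>U\<^sub>1 V\<^sub>1 U\<^sub>2 V\<^sub>2. (U\<^sub>1, V\<^sub>1) \<noteq> (U\<^sub>2, V\<^sub>2) \<and>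
      solves_S \<rho> a b \<alpha> U\<^sub>1 V\<^sub>1 \<and> solves_S \<rho> a b \<alpha> U\<^sub>2 V\<^sub>2 \<and>
      U\<^sub>1 \<in> H1_rd \<and> (\<forall>x. U\<^sub>1 x > 0) \<and> (\<forall>x. V\<^sub>1 x = - ((\<alpha> / a) powr (1/2)) * U\<^sub>1 x) \<and>
      U\<^sub>2 \<in> H1_rd \<and> (\<forall>x. U\<^sub>2 x > 0) \<and> (\<forall>x. V\<^sub>2 x = (\<alpha> / a) powr (1/2) * U\<^sub>2 x)"
    by (intro exI[of _ U\<^sub>1] exI[of _ "\<lambda>x. - ((\<alpha> / a) powr (1/2)) * U\<^sub>1 x"]
        exI[of _ U\<^sub>2] exI[of _ "\<lambda>x. (\<alpha> / a) powr (1/2) * U\<^sub>2 x"]) simp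
next
  fix a b :: real
  assume ab: "a > 0" "b > 0"
  \<comment> \<open>\<open>q\<close> depends only on \<rho>, \<open>a\<close> and \<open>b\<close>,
    so the threshold built from it is independent of \<alpha>. It is needed for the positive branch
    only.\<close>
  define q where "q = min \<rho> (a / (2 * b))"
  show "\<exists>\<alpha>\<^sub>0>0. \<forall>\<alpha>. 0 < \<alpha> \<and> \<alpha> < \<alpha>\<^sub>0 \<longrightarrow>
      (\<exists>U\<^sub>1 V\<^sub>1 U\<^sub>2 V\<^sub>2. (U\<^sub>1, V\<^sub>1) \<noteq> (U\<^sub>2, V\<^sub>2) \<and>
        solves_S \<rho> a b \<alpha> U\<^sub>1 V\<^sub>1 \<and> solves_S \<rho> a b \<alpha> U\<^sub>2 V\<^sub>2 \<and>
        (\<forall>x. U\<^sub>1 x > 0) \<and> (\<forall>x. V\<^sub>1 x > 0) \<and> (\<forall>x. U\<^sub>2 x > 0) \<and> (\<forall>x. V\<^sub>2 x < 0) \<and>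
        U\<^sub>1 \<in> H1 \<and> U\<^sub>2 \<in> H1 \<and>
        (\<forall>x. a * V\<^sub>1 x ^ 2 - b * V\<^sub>1 x ^ 3 = \<alpha> * U\<^sub>1 x ^ 2) \<and>
        (\<forall>x. a * V\<^sub>2 x ^ 2 - b * V\<^sub>2 x ^ 3 = \<alpha> * U\<^sub>2 x ^ 2))"
  proof (intro exI[of _ "q * sqrt (a / (8 * \<rho>))"] conjI allI impI; (elim conjE)?)
    show "q * sqrt (a / (8 * \<rho>)) > 0"
      using ab assms by (simp add: q_def)
    fix \<alpha> assume \<alpha>: "0 < \<alpha>" "\<alpha> < q * sqrt (a / (8 * \<rho>))"
    obtain U\<^sub>1 V\<^sub>1 where 1: "solves_S \<rho> a b \<alpha> U\<^sub>1 V\<^sub>1" "\<And>x. U\<^sub>1 x > 0" "\<And>x. V\<^sub>1 x > 0" "U\<^sub>1 \<in> H1"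
      "\<And>x. a * V\<^sub>1 x ^ 2 - b * V\<^sub>1 x ^ 3 = \<alpha> * U\<^sub>1 x ^ 2"
      using solution_cubic_positive[OF ab \<alpha>(1) assms q_def \<alpha>(2)] by blast
    obtain U\<^sub>2 V\<^sub>2 where 2: "solves_S \<rho> a b \<alpha> U\<^sub>2 V\<^sub>2" "\<And>x. U\<^sub>2 x > 0" "\<And>x. V\<^sub>2 x < 0" "U\<^sub>2 \<in> H1"
      "\<And>x. a * V\<^sub>2 x ^ 2 - b * V\<^sub>2 x ^ 3 = \<alpha> * U\<^sub>2 x ^ 2"
      using solution_cubic_negative[OF ab \<alpha>(1) assms] by blast
    have "V\<^sub>1 \<noteq> V\<^sub>2"
      using 1(3)[of 0] 2(3)[of 0] by auto
    with 1 2 show "\<exists>U\<^sub>1 V\<^sub>1 U\<^sub>2 V\<^sub>2. (U\<^sub>1, V\<^sub>1) \<noteq> (U\<^sub>2, V\<^sub>2) \<and>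
        solves_S \<rho> a b \<alpha> U\<^sub>1 V\<^sub>1 \<and> solves_S \<rho> a b \<alpha> U\<^sub>2 V\<^sub>2 \<and>
        (\<forall>x. U\<^sub>1 x > 0) \<and> (\<forall>x. V\<^sub>1 x > 0) \<and> (\<forall>x. U\<^sub>2 x > 0) \<and> (\<forall>x. V\<^sub>2 x < 0) \<and>
        U\<^sub>1 \<in> H1 \<and> U\<^sub>2 \<in> H1 \<and>
        (\<forall>x. a * V\<^sub>1 x ^ 2 - b * V\<^sub>1 x ^ 3 = \<alpha> * U\<^sub>1 x ^ 2) \<and>
        (\<forall>x. a * V\<^sub>2 x ^ 2 - b * V\<^sub>2 x ^ 3 = \<alpha> * U\<^sub>2 x ^ 2)"
      by (intro exI[of _ U\<^sub>1] exI[of _ V\<^sub>1] exI[of _ U\<^sub>2] exI[of _ V\<^sub>2]) simp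
  qed
qed

end
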